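(* The tree-independence number of any $W_4$-induced-minor-free graph is at most $4$.
   Context: All graphs are finite, simple and undirected. $W_4$ is the graph obtained from the $4$-vertex cycle by adding a universal vertex. A graph $G$ is $H$-induced-minor-free if no graph isomorphic to $H$ can be obtained from $G$ by a sequence of vertex deletions and edge contractions. A tree decomposition of $G$ is a pair $(T,\{X_t\}_{t\in V(T)})$ with $T$ a tree and bags $X_t\subseteq V(G)$ such that every vertex is in some bag, both endpoints of every edge are in a common bag, and for every vertex $u$ the set $\{t:u\in X_t\}$ induces a connected subgraph of $T$. The independence number of a tree decomposition is $\max_t\alpha(G[X_t])$, where $\alpha$ is the maximum size of an independent set. The tree-independence number of $G$ is the minimum independence number over all tree decompositions of $G$. *)

theory Defs
  imports "Graph_Theory.Digraph_Isomorphism"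
begin

text \<open>
  A finite simple undirected graph is a \<^locale>\<open>pair_graph\<close>: a finite vertex set with a symmetric
  irreflexive edge relation. The null graph is allowed.
\<close>

definition independent_set :: "('a, 'b) pre_digraph \<Rightarrow> 'a set \<Rightarrow> bool" where
  "independent_set G S \<longleftrightarrow> S \<subseteq> verts G \<and> (\<forall>u\<in>S. \<forall>v\<in>S. (u, v) \<notin> arcs_ends G)"

definition independence_number :: "('a, 'b) pre_digraph \<Rightarrow> nat" where
  "independence_number G = Max (card ` {S. independent_set G S})"

text \<open>
  The library's \<^const>\<open>tree\<close> is meant for digraphs: it counts a walk along an edge and back as a
  cycle, so no symmetric graph with an edge satisfies it. In an undirected simple graph the cycles
  are the library's cycles of length at least 3. By the definition of \<^const>\<open>connected\<close>, trees are
  nonempty.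
\<close>

definition undirected_tree :: "'t pair_pre_digraph \<Rightarrow> bool" where
  "undirected_tree T \<longleftrightarrow> pair_graph T \<and> connected (with_proj T) \<and>
     \<not> (\<exists>p. pre_digraph.cycle (with_proj T) p \<and> length p \<ge> 3)"

definition tree_decomposition ::
  "'a pair_pre_digraph \<Rightarrow> 't pair_pre_digraph \<Rightarrow> ('t \<Rightarrow> 'a set) \<Rightarrow> bool" where
  "tree_decomposition G T X \<longleftrightarrow>
     undirected_tree T \<and>
     (\<forall>t\<in>pverts T. X t \<subseteq> pverts G) \<and>
     (\<forall>u\<in>pverts G. \<exists>t\<in>pverts T. u \<in> X t) \<and>
     (\<forall>(u, v)\<in>parcs G. \<exists>t\<in>pverts T. u \<in> X t \<and> v \<in> X t) \<and>
     (\<forall>u\<in>pverts G. connected (with_proj T \<restriction> {t \<in> pverts T. u \<in> X t}))"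

definition decomposition_independence_number ::
  "'a pair_pre_digraph \<Rightarrow> 't pair_pre_digraph \<Rightarrow> ('t \<Rightarrow> 'a set) \<Rightarrow> nat" where
  "decomposition_independence_number G T X =
     Max ((\<lambda>t. independence_number (with_proj G \<restriction> X t)) ` pverts T)"

text \<open>
  Every finite tree is isomorphic to one whose nodes are natural numbers, so ranging over trees on
  \<^typ>\<open>nat\<close> covers all tree decompositions.
\<close>

definition tree_independence_number :: "'a pair_pre_digraph \<Rightarrow> nat" where
  "tree_independence_number G =
     (LEAST k. \<exists>(T :: nat pair_pre_digraph) X.
        tree_decomposition G T X \<and> decomposition_independence_number G T X = k)"

definition delete_vertex :: "'a pair_pre_digraph \<Rightarrow> 'a \<Rightarrow> 'a pair_pre_digraph" where
  "delete_vertex G v =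
     \<lparr> pverts = pverts G - {v}, parcs = {(x, y) \<in> parcs G. x \<noteq> v \<and> y \<noteq> v} \<rparr>"

text \<open>
  Contraction of the edge \<open>uv\<close>: the merged vertex is called \<open>u\<close>. The loop this creates is
  removed, and parallel edges coincide since edges form a set of pairs.
\<close>

definition contract_edge :: "'a pair_pre_digraph \<Rightarrow> 'a \<Rightarrow> 'a \<Rightarrow> 'a pair_pre_digraph" where
  "contract_edge G u v =
     (let f = (\<lambda>x. if x = v then u else x)
      in \<lparr> pverts = f ` pverts G,
           parcs = {(f x, f y) | x y. (x, y) \<in> parcs G \<and> f x \<noteq> f y} \<rparr>)"

inductive reduces_to :: "'a pair_pre_digraph \<Rightarrow> 'a pair_pre_digraph \<Rightarrow> bool"
  for G :: "'a pair_pre_digraph" where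
  refl: "reduces_to G G"
| delete: "reduces_to G H \<Longrightarrow> v \<in> pverts H \<Longrightarrow> reduces_to G (delete_vertex H v)"
| contract: "reduces_to G H \<Longrightarrow> (u, v) \<in> parcs H \<Longrightarrow> reduces_to G (contract_edge H u v)"

definition induced_minor_free :: "'h pair_pre_digraph \<Rightarrow> 'a pair_pre_digraph \<Rightarrow> bool" where
  "induced_minor_free H G \<longleftrightarrow>
     \<not> (\<exists>G'. reduces_to G G' \<and> digraph_iso (with_proj G') (with_proj H))"

text \<open>The 4-cycle \<open>0-1-2-3-0\<close> with universal vertex \<open>4\<close>.\<close>

definition W4 :: "nat pair_pre_digraph" where
  "W4 = (let E = {(0, 1), (1, 2), (2, 3), (3, 0), (4, 0), (4, 1), (4, 2), (4, 3)}
         in \<lparr> pverts = {0, 1, 2, 3, 4}, parcs = E \<union> E\<inverse> \<rparr>)"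

text \<open>
  The operations above stay within finite simple graphs, and the minimum defining
  \<^const>\<open>tree_independence_number\<close> is attained.
\<close>

lemma pair_graph_W4: "pair_graph W4"
  by unfold_locales (auto simp: W4_def Let_def symmetric_def sym_def)

lemma delete_vertex_del_vert:
  "with_proj (delete_vertex G v) = pre_digraph.del_vert (with_proj G) v"
  by (auto simp: delete_vertex_def with_proj_def pre_digraph.del_vert_def)

lemma pair_graph_iff: "pair_graph G \<longleftrightarrow> finite (pverts G) \<and> parcs G \<subseteq> pverts G \<times> pverts G \<and> sym (parcs G) \<and> irrefl (parcs G)"
proof
  assume "pair_graph G"
  then interpret pair_graph G .
  have "irrefl (parcs G)"
    using pair_no_loops by (force simp: irrefl_def)
  moreover have "sym (parcs G)"
    using sym_arcs by (simp add: symmetric_def)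
  ultimately show "finite (pverts G) \<and> parcs G \<subseteq> pverts G \<times> pverts G \<and> sym (parcs G) \<and> irrefl (parcs G)"
    using in_arcsD1 in_arcsD2 pair_finite_verts by auto
next
  assume *: "finite (pverts G) \<and> parcs G \<subseteq> pverts G \<times> pverts G \<and> sym (parcs G) \<and> irrefl (parcs G)"
  then have "finite (parcs G)" using finite_subset by blast
  with * show "pair_graph G"
    by unfold_locales (auto simp: symmetric_def irrefl_def)
qed

lemma pair_graph_delete: "pair_graph G \<Longrightarrow> pair_graph (delete_vertex G v)"
  by (auto simp: pair_graph_iff delete_vertex_def sym_def irrefl_def)

lemma pair_graph_contract: "pair_graph G \<Longrightarrow> pair_graph (contract_edge G u v)"
  unfolding pair_graph_iff
proof (intro conjI; elim conjE)
  assume *: "finite (pverts G)" "parcs G \<subseteq> pverts G \<times> pverts G" "sym (parcs G)" "irrefl (parcs G)"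
  show "finite (pverts (contract_edge G u v))"
    using * by (simp add: contract_edge_def Let_def)
  show "parcs (contract_edge G u v) \<subseteq> pverts (contract_edge G u v) \<times> pverts (contract_edge G u v)"
    using * unfolding contract_edge_def Let_def pair_pre_digraph.simps by blast
  have mem: "(a, b) \<in> parcs (contract_edge G u v) \<longleftrightarrow>
      (\<exists>x y. a = (if x = v then u else x) \<and> b = (if y = v then u else y) \<and> (x, y) \<in> parcs G \<and> a \<noteq> b)"
    for a b
    by (auto simp: contract_edge_def Let_def)
  show "sym (parcs (contract_edge G u v))"
    unfolding sym_def mem using symD[OF *(3)] by metis
  show "irrefl (parcs (contract_edge G u v))"
    unfolding contract_edge_def Let_def pair_pre_digraph.simps irrefl_def by blast
qed

lemma reduces_to_pair_graph: "reduces_to G H \<Longrightarrow> pair_graph G \<Longrightarrow> pair_graph H"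
  by (induction rule: reduces_to.induct) (auto intro: pair_graph_delete pair_graph_contract)

lemma undirected_tree_singleton: "undirected_tree \<lparr> pverts = {t}, parcs = {} \<rparr>"
  by (auto simp: undirected_tree_def pair_graph_iff sym_def irrefl_def connected_def
     strongly_connected_def mk_symmetric_def pre_digraph.cycle_def pre_digraph.awalk_def reachable_def with_proj_def)

lemma tree_decomposition_trivial: "pair_graph G \<Longrightarrow> tree_decomposition G \<lparr> pverts = {t}, parcs = {} \<rparr> (\<lambda>_. pverts G)"
  unfolding tree_decomposition_def
  by (auto simp: undirected_tree_singleton pair_graph_iff connected_def strongly_connected_def mk_symmetric_def reachable_def with_proj_def induce_subgraph_def split: prod.splits)

lemma tree_independence_number_attained:
  assumes "pair_graph G"
  shows "\<exists>(T :: nat pair_pre_digraph) X.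
    tree_decomposition G T X \<and> decomposition_independence_number G T X = tree_independence_number G"
proof -
  let ?P = "\<lambda>k. \<exists>(T :: nat pair_pre_digraph) X.
    tree_decomposition G T X \<and> decomposition_independence_number G T X = k"
  have "\<exists>k. ?P k"
    by (intro exI conjI, rule tree_decomposition_trivial[OF assms], rule HOL.refl)
  then have "?P (LEAST k. ?P k)"
    by (rule LeastI_ex[where P = ?P])
  then show ?thesis
    unfolding tree_independence_number_def .
qed

end

theory Submission
  imports Defs
begin

text \<open>
  A non-complete graph in which no separator is a clique or has at most two vertices contains \<open>W\<^sub>4\<close>
  as an induced minor: it has a hole, some component \<open>K\<close> of the rest attaches to at least three
  vertices of the hole, and two nonadjacent attachments \<open>x\<close>, \<open>y\<close> cut the hole into arcs \<open>P\<close> and \<open>Z\<close>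
  such that \<open>K\<close> touches \<open>Z\<close>. Since \<open>x\<close> and \<open>y\<close> do not separate \<open>P\<close> from \<open>Z \<union> K\<close>, one of \<open>Z\<close>, \<open>K\<close>
  can be enlarged until it touches \<open>P\<close>, and then it is the hub of a \<open>W\<^sub>4\<close> whose cycle consists of
  \<open>x\<close>, \<open>P\<close>, \<open>y\<close> and the other of the two.

  Hence a \<open>W\<^sub>4\<close>-induced-minor-free graph can be cut along clique separators and separators \<open>{a, b}\<close>,
  the latter made cliques by a virtual edge \<open>ab\<close>, until all pieces are complete. In a piece, five
  vertices that are independent in the original graph are joined by virtual edges only; keeping all
  but two disjoint ones of these gives \<open>W\<^sub>4\<close>. So each piece is a bag of independence number at most 4.
\<close>

section \<open>Connected sets and separations\<close>

text \<open>Graphs are treated as a vertex set with a bare relation: adding or dropping virtual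
  edges is then a union or difference of relations on unchanged vertices.\<close>

definition touching :: "'a rel \<Rightarrow> 'a set \<Rightarrow> 'a set \<Rightarrow> bool" where
  "touching E A B \<longleftrightarrow> (\<exists>a\<in>A. \<exists>b\<in>B. (a, b) \<in> E)"

definition conn_set :: "'a rel \<Rightarrow> 'a set \<Rightarrow> bool" where
  "conn_set E A \<longleftrightarrow> A \<noteq> {} \<and> (\<forall>x\<in>A. \<forall>y\<in>A. (x, y) \<in> (Restr E A)\<^sup>*)"

definition component :: "'a rel \<Rightarrow> 'a set \<Rightarrow> 'a \<Rightarrow> 'a set" where
  "component E R v = (Restr E R)\<^sup>* `` {v}"

definition nbrs :: "'a rel \<Rightarrow> 'a set \<Rightarrow> 'a set \<Rightarrow> 'a set" where
  "nbrs E V C = {t \<in> V - C. touching E C {t}}"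

definition clique_in :: "'a rel \<Rightarrow> 'a set \<Rightarrow> bool" where
  "clique_in E S \<longleftrightarrow> (\<forall>x\<in>S. \<forall>y\<in>S. x \<noteq> y \<longrightarrow> (x, y) \<in> E)"

text \<open>The separator is \<open>V1 \<inter> V2\<close>. It may be empty, and the empty set is a
  clique, so disconnected graphs are covered by cuts along cliques.\<close>

definition separation :: "'a set \<Rightarrow> 'a rel \<Rightarrow> 'a set \<Rightarrow> 'a set \<Rightarrow> bool" where
  "separation V E V1 V2 \<longleftrightarrow>
     V1 \<union> V2 = V \<and> V1 - V2 \<noteq> {} \<and> V2 - V1 \<noteq> {} \<and> \<not> touching E (V1 - V2) (V2 - V1)"

section \<open>Basic facts on adjacency of sets, reachability and components\<close>

lemma touching_sym: "sym E \<Longrightarrow> touching E A B \<longleftrightarrow> touching E B A"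
  unfolding touching_def sym_def by blast

lemma touching_mono: "touching E A B \<Longrightarrow> A \<subseteq> A' \<Longrightarrow> B \<subseteq> B' \<Longrightarrow> touching E A' B'"
  unfolding touching_def by blast

lemma separation_sym: "sym E \<Longrightarrow> separation V E V1 V2 \<Longrightarrow> separation V E V2 V1"
  unfolding separation_def by (metis Un_commute touching_sym)

lemma rtrancl_Restr_mono:
  "(x, y) \<in> (Restr E A)\<^sup>* \<Longrightarrow> A \<subseteq> B \<Longrightarrow> (x, y) \<in> (Restr E B)\<^sup>*"
  by (rule rtrancl_mono[THEN subsetD]) auto

lemma sym_rtrancl_Restr: "sym E \<Longrightarrow> (x, y) \<in> (Restr E A)\<^sup>* \<Longrightarrow> (y, x) \<in> (Restr E A)\<^sup>*"
  by (rule symD[OF sym_rtrancl]) (auto simp: sym_def)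

lemma conn_setI_root:
  assumes "sym E" "r \<in> A" "\<And>x. x \<in> A \<Longrightarrow> (r, x) \<in> (Restr E A)\<^sup>*"
  shows "conn_set E A"
  unfolding conn_set_def
  using assms sym_rtrancl_Restr[OF assms(1)] by (metis emptyE rtrancl_trans)

lemma conn_set_singleton [simp]: "conn_set E {x}"
  by (simp add: conn_set_def)

lemma conn_set_nonempty: "conn_set E A \<Longrightarrow> A \<noteq> {}"
  by (simp add: conn_set_def)

lemma conn_setD: "conn_set E A \<Longrightarrow> x \<in> A \<Longrightarrow> y \<in> A \<Longrightarrow> A \<subseteq> B \<Longrightarrow> (x, y) \<in> (Restr E B)\<^sup>*"
  unfolding conn_set_def using rtrancl_Restr_mono by metis

lemma conn_set_Un:
  assumes "sym E" "conn_set E A" "conn_set E B" "touching E A B"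
  shows "conn_set E (A \<union> B)"
proof -
  obtain a b where ab: "a \<in> A" "b \<in> B" "(a, b) \<in> E"
    using assms(4) by (auto simp: touching_def)
  have "(a, x) \<in> (Restr E (A \<union> B))\<^sup>*" if "x \<in> A \<union> B" for x
  proof (cases "x \<in> A")
    case True
    then show ?thesis using conn_setD[OF assms(2) ab(1)] by blast
  next
    case False
    then have "(b, x) \<in> (Restr E (A \<union> B))\<^sup>*"
      using that conn_setD[OF assms(3) ab(2)] by blast
    moreover have "(a, b) \<in> Restr E (A \<union> B)"
      using ab by blast
    ultimately show ?thesis by (rule converse_rtrancl_into_rtrancl[rotated])
  qed
  then show ?thesis
    using conn_setI_root[OF assms(1), of a "A \<union> B"] ab(1) by blast
qed

lemma conn_set_image_interval:
  assumes "sym E" "i \<le> j" "\<And>k. i \<le> k \<Longrightarrow> k < j \<Longrightarrow> (p k, p (Suc k)) \<in> E"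
  shows "conn_set E (p ` {i..j})"
  using assms(2,3)
proof (induction j rule: dec_induct)
  case base
  then show ?case by simp
next
  case (step j)
  have "conn_set E (p ` {i..j} \<union> {p (Suc j)})"
    using step.IH step.prems step.hyps
    by (intro conn_set_Un[OF assms(1)]) (force simp: touching_def)+
  moreover have "p ` {i..Suc j} = p ` {i..j} \<union> {p (Suc j)}"
    using step.hyps by (auto simp: atLeastAtMostSuc_conv)
  ultimately show ?case by simp
qed

lemma component_refl: "v \<in> component E R v"
  by (simp add: component_def)

lemma component_subset:
  assumes "v \<in> R"
  shows "component E R v \<subseteq> R"
proof
  fix w assume "w \<in> component E R v"
  then have "(v, w) \<in> (Restr E R)\<^sup>*" by (simp add: component_def)
  then show "w \<in> R" using assms by (induction) auto
qed

lemma component_closed: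
  "v \<in> R \<Longrightarrow> x \<in> component E R v \<Longrightarrow> y \<in> R \<Longrightarrow> (x, y) \<in> E \<Longrightarrow> y \<in> component E R v"
  using component_subset[of v R E]
  by (auto simp: component_def intro: rtrancl_into_rtrancl)

lemma conn_set_component:
  assumes "sym E" "v \<in> R"
  shows "conn_set E (component E R v)"
proof (rule conn_setI_root[OF assms(1) component_refl])
  let ?C = "component E R v"
  fix x assume "x \<in> ?C"
  then have "(v, x) \<in> (Restr E R)\<^sup>*" by (simp add: component_def)
  then show "(v, x) \<in> (Restr E ?C)\<^sup>*"
  proof induction
    case base
    then show ?case by simp
  next
    case (step y z)
    have "y \<in> ?C" using step(1) by (simp add: component_def)
    moreover from this have "z \<in> ?C"
      using component_closed[OF assms(2)] step(2) by blast
    ultimately show ?case using step by (meson IntD1 IntI SigmaI rtrancl.rtrancl_into_rtrancl)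
  qed
qed

lemma conn_set_subset_component:
  "conn_set E A \<Longrightarrow> A \<subseteq> R \<Longrightarrow> v \<in> A \<Longrightarrow> A \<subseteq> component E R v"
  using conn_setD[of E A v _ R] by (auto simp: component_def)

text \<open>This is the source of the separations used against the connectivity hypotheses.
  \<open>T\<close> may exceed the neighbourhood of \<open>C\<close>, so a bound on the neighbours
  suffices; \<open>z\<close> witnesses that something remains on the far side.\<close>

lemma separation_nbrs:
  assumes "C \<subseteq> V" "C \<noteq> {}" "nbrs E V C \<subseteq> T" "T \<subseteq> V - C" "z \<in> V - C - T"
  shows "separation V E (C \<union> T) (V - C)" "(C \<union> T) \<inter> (V - C) = T"
  using assms by (auto simp: separation_def nbrs_def touching_def)

text \<open>A shortest walk from \<open>a\<close> to \<open>b\<close> through \<open>B\<close> has no shortcuts.\<close>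

lemma induced_path_through:
  assumes "sym E" "conn_set E B" "a \<notin> B" "b \<notin> B" "a \<noteq> b" "(a, b) \<notin> E"
    and "touching E {a} B" "touching E B {b}"
  obtains p :: "nat \<Rightarrow> 'a" and n where "2 \<le> n" "p 0 = a" "p n = b"
    "\<And>i. 0 < i \<Longrightarrow> i < n \<Longrightarrow> p i \<in> B" "inj_on p {..n}"
    "\<And>i j. i < j \<Longrightarrow> j \<le> n \<Longrightarrow> (p i, p j) \<in> E \<longleftrightarrow> j = Suc i"
proof -
  define R where "R = Restr E (B \<union> {a, b})"
  have "conn_set E ({a} \<union> B \<union> {b})"
    using assms by (intro conn_set_Un) (auto intro: touching_mono)
  then have "(a, b) \<in> R\<^sup>*"
    unfolding R_def by (rule conn_setD) auto
  then have ex: "\<exists>n. (a, b) \<in> R ^^ n" by (metis rtrancl_imp_relpow)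
  define n where "n = (LEAST n. (a, b) \<in> R ^^ n)"
  have n: "(a, b) \<in> R ^^ n" unfolding n_def using ex by (metis LeastI)
  have least: "n \<le> m" if "(a, b) \<in> R ^^ m" for m
    unfolding n_def using that by (rule Least_le)
  obtain p where p: "p 0 = a" "p n = b" "\<And>i. i < n \<Longrightarrow> (p i, p (Suc i)) \<in> R"
    using n unfolding relpow_fun_conv by blast
  \<comment> \<open>Initial and final pieces of the walk can be spliced together: a repeated vertex
    or a chord would give a walk from \<open>a\<close> to \<open>b\<close> shorter than
    \<open>n\<close>.\<close>
  have seg: "(p i, p (i + d)) \<in> R ^^ d" if "i + d \<le> n" for i d
    using that
  proof (induction d)
    case (Suc d)
    then show ?case using p(3)[of "i + d"] by (auto intro: relcompI)
  qed simp
  have pre: "(a, p i) \<in> R ^^ i" if "i \<le> n" for i using seg[of 0 i] that p(1) by simp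
  have suf: "(p i, b) \<in> R ^^ (n - i)" if "i \<le> n" for i using seg[of i "n - i"] that p(2) by simp
  have inj: "inj_on p {..n}"
  proof (rule linorder_inj_onI')
    fix i j assume ij: "i \<in> {..n}" "j \<in> {..n}" "i < j"
    show "p i \<noteq> p j"
    proof
      assume "p i = p j"
      then have "(a, b) \<in> R ^^ (i + (n - j))"
        unfolding relpow_add using pre[of i] suf[of j] ij by auto
      then show False using least[of "i + (n - j)"] ij by auto
    qed
  qed
  have n2: "2 \<le> n"
  proof (rule ccontr)
    assume "\<not> 2 \<le> n"
    then have "n = 0 \<or> n = 1" by auto
    then show False using n assms(5,6) by (auto simp: R_def)
  qed
  have mem: "p i \<in> B \<union> {a, b}" if "i \<le> n" for i
  proof (cases "i = n")
    case True then show ?thesis using p(2) by simp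
  next
    case False
    then show ?thesis using that p(3)[of i] by (auto simp: R_def)
  qed
  have "p i \<in> B" if i: "0 < i" "i < n" for i
  proof -
    have "p i \<noteq> p 0" "p i \<noteq> p n"
      using inj_onD[OF inj, of i 0] inj_onD[OF inj, of i n] i by auto
    then show ?thesis using mem[of i] i p by auto
  qed
  moreover have "(p i, p j) \<in> E \<longleftrightarrow> j = Suc i" if ij: "i < j" "j \<le> n" for i j
  proof
    assume "(p i, p j) \<in> E"
    then have "(p i, p j) \<in> R" using mem[of i] mem[of j] ij unfolding R_def by simp blast
    then have "(a, p j) \<in> R ^^ Suc i" using pre[of i] ij by auto
    then have "(a, b) \<in> R ^^ (Suc i + (n - j))" using suf[of j] ij
      unfolding relpow_add by auto
    then show "j = Suc i" using least[of "Suc i + (n - j)"] ij by auto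
  next
    assume "j = Suc i" then show "(p i, p j) \<in> E" using p(3)[of i] ij by (auto simp: R_def)
  qed
  ultimately show thesis using that n2 p inj by blast
qed

section \<open>Induced minor models\<close>

text \<open>The sets \<open>M i\<close> are the branch sets of an induced minor. They need not cover
  \<open>V\<close>; what lies outside them is to be deleted.\<close>

definition minor_model ::
  "'h pair_pre_digraph \<Rightarrow> 'a set \<Rightarrow> 'a rel \<Rightarrow> ('h \<Rightarrow> 'a set) \<Rightarrow> bool" where
  "minor_model H V E M \<longleftrightarrow>
     (\<forall>i\<in>pverts H. M i \<subseteq> V \<and> conn_set E (M i)) \<and>
     (\<forall>i\<in>pverts H. \<forall>j\<in>pverts H. i \<noteq> j \<longrightarrow>
        M i \<inter> M j = {} \<and> (touching E (M i) (M j) \<longleftrightarrow> (i, j) \<in> parcs H))"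

text \<open>The rim is \<open>A\<close>, \<open>P\<close>, \<open>B\<close>, \<open>Q\<close> in
  cyclic order and \<open>Z\<close> is the hub, so the two forbidden adjacencies are the diagonals
  of the rim.\<close>

lemma W4_modelI:
  assumes "sym E"
    and "conn_set E A" "conn_set E P" "conn_set E B" "conn_set E Q" "conn_set E Z"
    and "A \<subseteq> V" "P \<subseteq> V" "B \<subseteq> V" "Q \<subseteq> V" "Z \<subseteq> V"
    and "A \<inter> P = {}" "A \<inter> B = {}" "A \<inter> Q = {}" "A \<inter> Z = {}" "P \<inter> B = {}" "P \<inter> Q = {}"
      "P \<inter> Z = {}" "B \<inter> Q = {}" "B \<inter> Z = {}" "Q \<inter> Z = {}"
    and "touching E A P" "touching E B P" "touching E A Q" "touching E B Q"
      "touching E Z A" "touching E Z P" "touching E Z B" "touching E Z Q"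
    and "\<not> touching E A B" "\<not> touching E P Q"
  shows "\<exists>M. minor_model W4 V E M"
proof
  define M where "M = (\<lambda>i. [A, P, B, Q, Z] ! i)"
  have M: "M 0 = A" "M (Suc 0) = P" "M 2 = B" "M 3 = Q" "M 4 = Z"
    by (simp_all add: M_def numeral_nat)
  note t = assms(22-)
  have s: "touching E X Y \<longleftrightarrow> touching E Y X" for X Y by (rule touching_sym[OF assms(1)])
  have "(\<forall>i\<in>pverts W4. M i \<subseteq> V \<and> conn_set E (M i))"
    using assms(2-11) by (simp add: W4_def M)
  moreover have "touching E P A" "touching E P B" "touching E Q A" "touching E Q B"
    "touching E A Z" "touching E P Z" "touching E B Z" "touching E Q Z"
    "\<not> touching E B A" "\<not> touching E Q P"
    using t s by blast+
  with t have "\<forall>i\<in>pverts W4. \<forall>j\<in>pverts W4. i \<noteq> j \<longrightarrow>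
        (touching E (M i) (M j) \<longleftrightarrow> (i, j) \<in> parcs W4)"
    by (simp add: W4_def M)
  moreover have "\<forall>i\<in>pverts W4. \<forall>j\<in>pverts W4. i \<noteq> j \<longrightarrow> M i \<inter> M j = {}"
    using assms(12-21) by (simp add: W4_def M Int_commute)
  ultimately show "minor_model W4 V E M"
    unfolding minor_model_def by blast
qed

section \<open>Wheels in graphs without small or clique separators\<close>

text \<open>\<open>P\<close>, \<open>Z\<close> and \<open>K\<close> are three connections between
  \<open>x\<close> and \<open>y\<close>. Of \<open>Z\<close> and \<open>K\<close>, one becomes the
  hub and the other the rim part opposite \<open>P\<close>. They already touch each other, so only
  contact between the hub and \<open>P\<close> has to be created.\<close>

lemma W4_model_of_theta:
  assumes "sym E" and V: "x \<in> V" "y \<in> V" "P \<subseteq> V" "Z \<subseteq> V" "K \<subseteq> V"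
    and no_sep: "\<And>V1 V2. separation V E V1 V2 \<Longrightarrow> V1 \<inter> V2 \<noteq> {x, y}"
    and xy: "x \<noteq> y" "(x, y) \<notin> E"
    and conn: "conn_set E P" "conn_set E Z" "conn_set E K"
    and disj: "x \<notin> P \<union> Z \<union> K" "y \<notin> P \<union> Z \<union> K" "P \<inter> Z = {}" "P \<inter> K = {}" "Z \<inter> K = {}"
    and touch: "touching E P {x}" "touching E P {y}" "touching E Z {x}" "touching E Z {y}"
      "touching E K {x}" "touching E K {y}" "touching E Z K" "\<not> touching E P Z"
  shows "\<exists>M. minor_model W4 V E M"
proof -
  note s = touching_sym[OF \<open>sym E\<close>]
  \<comment> \<open>The cycle is \<open>x P y Q\<close>; once a hub touches \<open>P\<close>, nothing is missing.\<close>
  have wheel: ?thesis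
    if "Q \<subseteq> V" "H \<subseteq> V" "conn_set E Q" "conn_set E H" "x \<notin> Q \<union> H" "y \<notin> Q \<union> H"
      "P \<inter> Q = {}" "P \<inter> H = {}" "Q \<inter> H = {}" "touching E Q {x}" "touching E Q {y}"
      "touching E H {x}" "touching E H {y}" "touching E H Q" "touching E H P" "\<not> touching E P Q"
    for Q H
    using that V xy conn disj(1,2) touch(1,2) s[of "{x}"] s[of "{y}"] \<open>sym E\<close>
    by (intro W4_modelI[of E "{x}" P "{y}" Q H]) (auto simp: touching_def)
  show ?thesis
  proof (cases "touching E K P")
    case True
    then show ?thesis
      using V conn disj touch s[of K Z] by (intro wheel[of Z K]) auto
  next
    case KP: False
    obtain z where z: "z \<in> Z" using conn(2) conn_set_nonempty by blast
    \<comment> \<open>\<open>Z\<close> is enlarged as far as possible without meeting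
      \<open>x\<close>, \<open>y\<close>, \<open>P\<close> or \<open>K\<close>, so \<open>K\<close>
      can still be the rim part if \<open>Z'\<close> reaches \<open>P\<close>.\<close>
    define R where "R = V - {x, y} - P - K"
    define Z' where "Z' = component E R z"
    have zR: "Z \<subseteq> R" using V disj by (auto simp: R_def)
    then have Z': "Z \<subseteq> Z'" "Z' \<subseteq> R" "conn_set E Z'"
      using z conn_set_subset_component[OF conn(2) zR z] component_subset[of z R E]
        conn_set_component[OF \<open>sym E\<close>, of z R] by (auto simp: Z'_def)
    then have Z'xy: "touching E Z' {x}" "touching E Z' {y}" "touching E Z' K"
      using touch touching_mono by blast+
    show ?thesis
    proof (cases "touching E Z' P")
      case True
      then show ?thesis using V conn disj touch KP s[of K P] Z' Z'xy
        by (intro wheel[of K Z']) (auto simp: R_def)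
    next
      case Z'P: False
      obtain k where k: "k \<in> K" using conn(3) conn_set_nonempty by blast
      \<comment> \<open>Now \<open>K\<close> is enlarged in the same way, avoiding the maximal
        \<open>Z'\<close>, which becomes the rim part if \<open>K'\<close> reaches
        \<open>P\<close>.\<close>
      define R' where "R' = V - {x, y} - P - Z'"
      define K' where "K' = component E R' k"
      have kR: "K \<subseteq> R'" using V disj Z'(2) by (auto simp: R'_def R_def)
      then have K': "K \<subseteq> K'" "K' \<subseteq> R'" "conn_set E K'"
        using k conn_set_subset_component[OF conn(3) kR k] component_subset[of k R' E]
          conn_set_component[OF \<open>sym E\<close>, of k R'] by (auto simp: K'_def)
      have K'xy: "touching E K' {x}" "touching E K' {y}" "touching E K' Z'"
        using touch touching_mono[OF touch(7) Z'(1) K'(1)] s[of K' Z'] touching_mono K'(1)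
        by blast+
      show ?thesis
      proof (cases "touching E K' P")
        case True
        then show ?thesis using V conn disj touch KP Z'P s[of Z' P] Z' Z'xy K' K'xy
          by (intro wheel[of Z' K']) (auto simp: R_def R'_def)
      next
        case K'P: False
        let ?C = "Z' \<union> K'"
        \<comment> \<open>A neighbour outside \<open>x\<close>, \<open>y\<close> and
          \<open>P\<close> would lie in both \<open>R\<close> and \<open>R'\<close>, and the
          component containing its neighbour would have absorbed it. Hence \<open>x\<close> and
          \<open>y\<close> cut \<open>?C\<close> off from \<open>P\<close>.\<close>
        have "nbrs E V ?C \<subseteq> {x, y}"
        proof
          fix t assume t: "t \<in> nbrs E V ?C"
          then obtain c where c: "c \<in> ?C" "(c, t) \<in> E" "t \<in> V" "t \<notin> ?C"
            by (auto simp: nbrs_def touching_def)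
          have "t \<notin> P" using c Z'P K'P by (auto simp: touching_def)
          show "t \<in> {x, y}"
          proof (rule ccontr)
            assume "t \<notin> {x, y}"
            then have "t \<in> R'" "t \<in> R" using c \<open>t \<notin> P\<close> K'(1) by (auto simp: R'_def R_def)
            then show False
              using c component_closed[of z R _ E t] component_closed[of k R' _ E t] z zR k kR
              by (auto simp: Z'_def K'_def)
          qed
        qed
        moreover obtain p where "p \<in> P" using conn(1) conn_set_nonempty by blast
        ultimately have "separation V E (?C \<union> {x, y}) (V - ?C)"
            "(?C \<union> {x, y}) \<inter> (V - ?C) = {x, y}"
          using V Z' K' z disj
          by (intro separation_nbrs[of ?C V E "{x, y}" p]; auto simp: R_def R'_def)+
        then show ?thesis using no_sep by blast
      qed
    qed
  qed
qed

section \<open>A hole and the attachments of a component to it\<close>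

lemma three_elements:
  assumes "3 \<le> card T"
  obtains a b c where "a \<in> T" "b \<in> T" "c \<in> T" "a \<noteq> b" "a \<noteq> c" "b \<noteq> c"
proof -
  obtain T' where "T' \<subseteq> T" "card T' = 3" using assms obtain_subset_with_card_n by metis
  then show thesis using that by (auto simp: card_3_iff)
qed

lemma three_ordered:
  fixes T :: "nat set"
  assumes "3 \<le> card T"
  obtains a b c where "a \<in> T" "b \<in> T" "c \<in> T" "a < b" "b < c"
proof -
  obtain a b c where *: "a \<in> T" "b \<in> T" "c \<in> T" "a \<noteq> b" "a \<noteq> c" "b \<noteq> c"
    using three_elements[OF assms] .
  consider "a < b \<and> b < c" | "a < c \<and> c < b" | "b < a \<and> a < c" | "b < c \<and> c < a"
    | "c < a \<and> a < b" | "c < b \<and> b < a" using *(4-6) by linarith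
  then show thesis using that * by cases auto
qed

text \<open>A hole is built from \<open>u\<close> and an induced path between two of its neighbours.
  A component \<open>K\<close> of the rest has at least three attachments on it; the cases below
  choose \<open>x\<close> and \<open>y\<close> among these so that a third attachment lies strictly
  inside the arc \<open>Z\<close>.\<close>

lemma W4_model_of_no_small_separation:
  assumes "sym E" "finite V"
    and no_sep: "\<And>V1 V2. separation V E V1 V2 \<Longrightarrow>
      3 \<le> card (V1 \<inter> V2) \<and> \<not> clique_in E (V1 \<inter> V2)"
    and "\<not> clique_in E V"
  shows "\<exists>M. minor_model W4 V E M"
proof -
  note s = touching_sym[OF \<open>sym E\<close>]
  have no2: "V1 \<inter> V2 \<noteq> {x, y}" if "separation V E V1 V2" for V1 V2 x y
  proof
    assume "V1 \<inter> V2 = {x, y}"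
    moreover have "card {x, y} \<le> 2" by (simp add: card_insert_if)
    ultimately show False using no_sep[OF that] by simp
  qed
  obtain u v where uv: "u \<in> V" "v \<in> V" "u \<noteq> v" "(u, v) \<notin> E"
    using assms(4) by (auto simp: clique_in_def)
  \<comment> \<open>\<open>R\<close> consists of the non-neighbours of \<open>u\<close>, and
    \<open>B\<close> is the component of \<open>v\<close> among them. Its neighbourhood
    \<open>S\<close> therefore separates \<open>v\<close> from \<open>u\<close>.\<close>
  define R where "R = {w \<in> V. w \<noteq> u \<and> (u, w) \<notin> E}"
  define B where "B = component E R v"
  define S where "S = nbrs E V B"
  have vR: "v \<in> R" using uv by (auto simp: R_def)
  have B: "v \<in> B" "B \<subseteq> R" "conn_set E B"
    using component_refl[of v E R] component_subset[OF vR] conn_set_component[OF \<open>sym E\<close> vR]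
    by (auto simp: B_def)
  have uB: "(u, w) \<notin> E" "w \<noteq> u" "w \<in> V" if "w \<in> B" for w using B that by (auto simp: R_def)
  \<comment> \<open>A vertex of \<open>S\<close> not adjacent to \<open>u\<close> would belong to
    \<open>R\<close> and hence to the component \<open>B\<close> itself.\<close>
  have S: "(u, w) \<in> E" "w \<in> V" "w \<notin> B" "touching E B {w}" if w: "w \<in> S" for w
  proof -
    obtain c where c: "c \<in> B" "(c, w) \<in> E" "w \<in> V" "w \<notin> B"
      using w by (auto simp: S_def nbrs_def touching_def)
    then have "w \<noteq> u" using uB(1)[of c] \<open>sym E\<close> by (auto dest: symD)
    show "(u, w) \<in> E"
    proof (rule ccontr)
      assume "(u, w) \<notin> E"
      then have "w \<in> R" using c \<open>w \<noteq> u\<close> by (auto simp: R_def)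
      then show False using component_closed[OF vR, of c E w] c by (auto simp: B_def)
    qed
    show "w \<in> V" "w \<notin> B" "touching E B {w}" using c by (auto simp: touching_def)
  qed
  have uS: "u \<notin> S" using uB(1) \<open>sym E\<close> by (auto simp: S_def nbrs_def touching_def dest: symD)
  have SV: "S \<subseteq> V - B" by (auto simp: S_def nbrs_def)
  have BV: "B \<subseteq> V" "B \<noteq> {}" "u \<in> V - B - S" using B uB uS uv by auto
  have "\<not> clique_in E S"
    using separation_nbrs[OF BV(1,2) _ SV BV(3), of E] no_sep[of "B \<union> S" "V - B"] by (simp add: S_def)
  then obtain a b where ab: "a \<in> S" "b \<in> S" "a \<noteq> b" "(a, b) \<notin> E"
    by (auto simp: clique_in_def)
  \<comment> \<open>The ends of this induced path are neighbours of \<open>u\<close>, its interior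
    lies in \<open>B\<close> and avoids them. So \<open>u\<close> closes it to a hole, whose vertex
    set is \<open>U\<close>.\<close>
  obtain p :: "nat \<Rightarrow> 'a" and n where n: "2 \<le> n" and p0: "p 0 = a" and pn: "p n = b"
    and pB: "\<And>i. 0 < i \<Longrightarrow> i < n \<Longrightarrow> p i \<in> B" and inj: "inj_on p {..n}"
    and adj: "\<And>i j. i < j \<Longrightarrow> j \<le> n \<Longrightarrow> (p i, p j) \<in> E \<longleftrightarrow> j = Suc i"
  proof (rule induced_path_through[OF \<open>sym E\<close> B(3), of a b])
    show "touching E {a} B" using S(4)[OF ab(1)] s[of B "{a}"] by simp
  qed (use ab S(3,4) in auto)
  have adj': "(p i, p j) \<in> E \<longleftrightarrow> j = Suc i \<or> i = Suc j" if "i \<noteq> j" "i \<le> n" "j \<le> n" for i j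
    using that adj[of i j] adj[of j i] symD[OF \<open>sym E\<close>, of "p i" "p j"]
      symD[OF \<open>sym E\<close>, of "p j" "p i"] by (cases i j rule: linorder_cases) auto
  have peq: "p i = p j \<longleftrightarrow> i = j" if "i \<le> n" "j \<le> n" for i j
    using inj that by (auto dest: inj_onD)
  have pV: "p i \<in> V" "p i \<noteq> u" if "i \<le> n" for i
  proof -
    have "p i \<in> B \<union> S"
    proof (cases "i = 0 \<or> i = n")
      case True then show ?thesis using p0 pn ab by auto
    next
      case False then show ?thesis using pB[of i] that by simp
    qed
    then show "p i \<in> V" "p i \<noteq> u" using uB S uS by auto
  qed
  have up: "(u, p i) \<in> E \<longleftrightarrow> i = 0 \<or> i = n" if "i \<le> n" for i
  proof (cases "i = 0 \<or> i = n")
    case True then show ?thesis using p0 pn ab S(1) by auto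
  next
    case False then show ?thesis using pB[of i] uB(1) that by simp
  qed
  have arc: "conn_set E (p ` {i..j})" if "i \<le> j" "j \<le> n" for i j
    using that adj by (intro conn_set_image_interval \<open>sym E\<close>) auto
  define U where "U = insert u (p ` {..n})"
  have UV: "U \<subseteq> V" using pV uv by (auto simp: U_def)
  \<comment> \<open>A hole alone is separated by the two neighbours of a vertex.\<close>
  have "V - U \<noteq> {}"
  proof
    assume "V - U = {}"
    then have VU: "V = U" using UV by blast
    have 1: "nbrs E V {p 1} \<subseteq> {p 0, p 2}"
    proof
      fix t assume "t \<in> nbrs E V {p 1}"
      then have t: "(p 1, t) \<in> E" "t \<noteq> p 1" "t \<in> U" by (auto simp: nbrs_def touching_def VU)
      have "t \<noteq> u" using t up[of 1] n \<open>sym E\<close> by (auto dest: symD)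
      then obtain i where i: "t = p i" "i \<le> n" "i \<noteq> 1" using t by (auto simp: U_def)
      then have "i = 2 \<or> i = 0" using t adj'[of 1 i] n by auto
      then show "t \<in> {p 0, p 2}" using i by auto
    qed
    have "separation V E ({p 1} \<union> {p 0, p 2}) (V - {p 1})"
      "({p 1} \<union> {p 0, p 2}) \<inter> (V - {p 1}) = {p 0, p 2}"
      using 1 pV(1)[of 0] pV(1)[of 1] pV(1)[of 2] pV(2)[of 0] pV(2)[of 1] pV(2)[of 2]
        n uv peq[of 0 1] peq[of 2 1]
      by (intro separation_nbrs[of "{p 1}" V E "{p 0, p 2}" u]; auto)+
    then show False using no2 by blast
  qed
  then obtain x where x: "x \<in> V - U" by blast
  define K where "K = component E (V - U) x"
  define T where "T = nbrs E V K"
  have K: "x \<in> K" "K \<subseteq> V - U" "conn_set E K"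
    using component_refl[of x E "V - U"] component_subset[OF x] conn_set_component[OF \<open>sym E\<close> x]
    by (auto simp: K_def)
  have TU: "T \<subseteq> U"
    using component_closed[OF x, of _ E] K(2) UV
    by (auto simp: T_def nbrs_def touching_def K_def)
  have tK: "touching E K {t}" if "t \<in> T" for t using that by (auto simp: T_def nbrs_def)
  have cU: "card U = n + 2"
    using pV by (subst U_def, subst card_insert_disjoint) (auto simp: card_image inj)
  \<comment> \<open>Either every vertex of the hole is an attachment, or \<open>T\<close> separates
    \<open>K\<close> from a hole vertex and is large by hypothesis.\<close>
  have T3: "3 \<le> card T"
  proof (cases "T = U")
    case True then show ?thesis using cU n by simp
  next
    case False
    then obtain z where "z \<in> U" "z \<notin> T" using TU by blast
    then have z: "z \<in> V - K - T" using UV K(2) by auto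
    have KV: "K \<subseteq> V" "K \<noteq> {}" "T \<subseteq> V - K" using K by (auto simp: T_def nbrs_def)
    show ?thesis
      using separation_nbrs[OF KV(1,2) _ KV(3) z, of E] no_sep[of "K \<union> T" "V - K"]
      by (simp add: T_def)
  qed
  have Kd: "p ` {i..j} \<inter> K = {}" "u \<notin> K" "i \<le> n \<Longrightarrow> p i \<notin> K" if "j \<le> n" for i j
    using K(2) that by (auto simp: U_def)
  have tpp: "touching E (p ` A) (p ` A') \<longleftrightarrow> (\<exists>i\<in>A. \<exists>j\<in>A'. i = Suc j \<or> j = Suc i)"
    if "A \<subseteq> {..n}" "A' \<subseteq> {..n}" "A \<inter> A' = {}" for A A'
  proof -
    have "(p i, p j) \<in> E \<longleftrightarrow> i = Suc j \<or> j = Suc i" if "i \<in> A" "j \<in> A'" for i j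
      using adj'[of i j] that \<open>A \<subseteq> {..n}\<close> \<open>A' \<subseteq> {..n}\<close> \<open>A \<inter> A' = {}\<close> by auto
    then show ?thesis by (simp add: touching_def)
  qed
  have tp: "touching E (p ` A) {p k} \<longleftrightarrow> (\<exists>i\<in>A. i = Suc k \<or> k = Suc i)"
    if "A \<subseteq> {..n}" "k \<le> n" "k \<notin> A" for A k
    using tpp[of A "{k}"] that by auto
  have tpK: "touching E (p ` A) K" if "i \<in> A" "p i \<in> T" for A i
    using tK[OF that(2)] that(1) s[of K "{p i}"] by (auto intro: touching_mono)
  have tuK: "touching E {u} K" if "u \<in> T"
    using tK[OF that] s[of K] by simp
  have tup: "touching E {u} (p ` A) \<longleftrightarrow> 0 \<in> A \<or> n \<in> A" if "A \<subseteq> {..n}" for A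
    using up that by (auto simp: touching_def)
  have dp: "p ` A \<inter> p ` A' = {}" if "A \<subseteq> {..n}" "A' \<subseteq> {..n}" "A \<inter> A' = {}" for A A'
    using inj_on_image_Int[OF inj that(1,2)] that(3) by simp
  have dk: "p k \<notin> p ` A" if "A \<subseteq> {..n}" "k \<le> n" "k \<notin> A" for A k
    using inj_on_image_mem_iff[OF inj, of k A] that by simp
  have du: "u \<notin> p ` A" if "A \<subseteq> {..n}" for A
    using that pV(2) by (metis atMost_iff imageE subsetD)
  note theta = W4_model_of_theta[OF \<open>sym E\<close>, of _ V, OF _ _ _ _ _ no2]
  show ?thesis
  proof (cases "u \<in> T")
    case False
    \<comment> \<open>All attachments lie on the path. With indices \<open>i < j < l\<close>, the
      cut vertices are \<open>p i\<close> and \<open>p l\<close>; \<open>?Z\<close> is the stretch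
      between them, touched by \<open>K\<close> at \<open>p j\<close>, and \<open>?P\<close> runs
      the other way round through \<open>u\<close>. The path pieces of \<open>?P\<close> may be
      empty.\<close>
    define I where "I = {i. i \<le> n \<and> p i \<in> T}"
    have "T = p ` I" using TU False by (auto simp: I_def U_def)
    then have "card T \<le> card I" using card_image_le[of I p] by (simp add: I_def)
    then obtain i j l where I: "i \<in> I" "j \<in> I" "l \<in> I" "i < j" "j < l"
      using three_ordered[of I] T3 by auto
    then have le: "l \<le> n" "p i \<in> T" "p j \<in> T" "p l \<in> T" by (auto simp: I_def)
    let ?Z = "p ` {Suc i..l - 1}"
    let ?P = "insert u (p ` {..<i} \<union> p ` {l<..n})"
    have cP: "conn_set E ?P"
    proof -
      have 1: "conn_set E ({u} \<union> p ` {..<i})"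
      proof (cases i)
        case (Suc i')
        then have "{..<i} = {0..i'}" by auto
        then show ?thesis using arc[of 0 i'] tup[of "{0..i'}"] Suc I le
          by (intro conn_set_Un \<open>sym E\<close>) auto
      qed simp
      show ?thesis
      proof (cases "l = n")
        case True
        then show ?thesis using 1 by simp
      next
        case False
        then have "{l<..n} = {Suc l..n}" by auto
        moreover have "touching E ({u} \<union> p ` {..<i}) (p ` {Suc l..n})"
          using tup[of "{Suc l..n}"] le False by (auto intro: touching_mono)
        ultimately have "conn_set E (({u} \<union> p ` {..<i}) \<union> p ` {l<..n})"
          using conn_set_Un[OF \<open>sym E\<close> 1 arc[of "Suc l" n]] le False by simp
        then show ?thesis by simp
      qed
    qed
    let ?O = "{..<i} \<union> {l<..n}" and ?D = "{Suc i..l - 1}"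
    have PU: "?P = {u} \<union> p ` ?O" by auto
    have O: "?O \<subseteq> {..n}" "i \<notin> ?O" "l \<notin> ?O" and D: "?D \<subseteq> {..n}" "i \<notin> ?D" "l \<notin> ?D" "j \<in> ?D"
      and OD: "?O \<inter> ?D = {}" "i \<le> n"
      using I le by auto
    have t_Un: "touching E ({u} \<union> A) A' \<longleftrightarrow> touching E {u} A' \<or> touching E A A'" for A A'
      by (auto simp: touching_def)
    have nZ: "\<not> touching E ?P ?Z"
      unfolding PU t_Un tup[OF D(1)] tpp[OF O(1) D(1) OD(1)] using I le by auto
    have Pi: "touching E ?P {p i}"
      unfolding PU t_Un tp[OF O(1) OD(2) O(2)] using tup[of "{i}"] I le by (cases i) auto
    have Pl: "touching E ?P {p l}"
      unfolding PU t_Un tp[OF O(1) le(1) O(3)] using tup[of "{l}"] I le by (cases "l = n") auto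
    have Z: "touching E ?Z {p i}" "touching E ?Z {p l}"
      unfolding tp[OF D(1) OD(2) D(2)] tp[OF D(1) le(1) D(3)] using I
      by (auto intro!: bexI[of _ "Suc i"] bexI[of _ "l - 1"])
    show ?thesis
    proof (rule theta[of "p i" "p l" ?P ?Z K])
      show "conn_set E ?Z" using arc[of "Suc i" "l - 1"] I le by simp
      show "touching E ?Z K" using tpK[OF D(4) le(3)] .
      show "?P \<inter> ?Z = {}" unfolding PU
        using dp[OF O(1) D(1) OD(1)] du[OF D(1)] by auto
      show "p i \<notin> ?P \<union> ?Z \<union> K" unfolding PU
        using dk[OF O(1) OD(2) O(2)] dk[OF D(1) OD(2) D(2)] pV(2)[OF OD(2)] Kd(3)[OF OD(2,2)] by auto
      show "p l \<notin> ?P \<union> ?Z \<union> K" unfolding PU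
        using dk[OF O(1) le(1) O(3)] dk[OF D(1) le(1) D(3)] pV(2)[OF le(1)] Kd(3)[OF le(1,1)] by auto
      show "?P \<inter> K = {}" "?Z \<inter> K = {}" using K(2) O(1) D(1) by (auto simp: U_def)
      show "?P \<subseteq> V" "?Z \<subseteq> V" "p i \<in> V" "p l \<in> V" using pV(1) uv O(1) D(1) OD(2) le(1) by auto
      show "p i \<noteq> p l" "(p i, p l) \<notin> E" using peq[OF OD(2) le(1)] adj[of i l] I le by auto
    qed (use K(2,3) UV tK[OF le(2)] tK[OF le(4)] cP nZ Pi Pl Z in auto)
  next
    case uT: True
    show ?thesis
    proof (cases "\<exists>m. 0 < m \<and> m < n \<and> p m \<in> T")
      case True
      then obtain m where m: "0 < m" "m < n" "p m \<in> T" by blast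
      have "\<exists>i. i \<le> n \<and> i \<noteq> m \<and> p i \<in> T"
      proof (rule ccontr)
        assume "\<not> ?thesis"
        then have "T \<subseteq> {u, p m}" using TU by (auto simp: U_def)
        then have "card T \<le> card {u, p m}" by (intro card_mono) auto
        then show False using T3 by (auto simp: card_insert_if split: if_splits)
      qed
      then obtain i where i: "i \<le> n" "i \<noteq> m" "p i \<in> T" by blast
      let ?A = "{0..m - 1}" and ?A' = "{Suc m..n}"
      \<comment> \<open>The hole is cut at \<open>u\<close> and the inner attachment
        \<open>p m\<close>. The third attachment \<open>p i\<close> may lie on either side;
        \<open>D'\<close> denotes that side and plays the role of \<open>Z\<close>.\<close>
      have side: ?thesis if D: "D = ?A \<and> D' = ?A' \<or> D = ?A' \<and> D' = ?A" and iD: "i \<in> D'" for D D'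
      proof (rule theta[of u "p m" "p ` D" "p ` D'" K])
        have D1: "D \<subseteq> {..n}" "D' \<subseteq> {..n}" "m \<notin> D" "m \<notin> D'" "D \<inter> D' = {}" "m \<le> n"
          using D m by auto
        show "p ` D \<subseteq> V" "p ` D' \<subseteq> V" "p m \<in> V" using D1 pV(1) by auto
        show "p ` D \<inter> p ` D' = {}" using dp[OF D1(1,2,5)] .
        show "conn_set E (p ` D)" "conn_set E (p ` D')"
          using D arc[of 0 "m - 1"] arc[of "Suc m" n] m by auto
        show "touching E (p ` D) {u}" "touching E (p ` D') {u}"
          unfolding s[of _ "{u}"] tup[OF D1(1)] tup[OF D1(2)] using D m by auto
        show "touching E (p ` D) {p m}" "touching E (p ` D') {p m}"
        proof -
          have "\<exists>i\<in>?A. i = Suc m \<or> m = Suc i" using m by (intro bexI[of _ "m - 1"]) auto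
          moreover have "\<exists>i\<in>?A'. i = Suc m \<or> m = Suc i" using m by (intro bexI[of _ "Suc m"]) auto
          ultimately show "touching E (p ` D) {p m}" "touching E (p ` D') {p m}"
            unfolding tp[OF D1(1,6,3)] tp[OF D1(2,6,4)] using D by blast+
        qed
        show "\<not> touching E (p ` D) (p ` D')"
          unfolding tpp[OF D1(1,2,5)] using D m by auto
        show "touching E (p ` D') K" using tpK[OF iD i(3)] .
        show "u \<notin> p ` D \<union> p ` D' \<union> K"
          using du[OF D1(1)] du[OF D1(2)] Kd(2)[of n] by auto
        show "p m \<notin> p ` D \<union> p ` D' \<union> K"
          using dk[OF D1(1,6,3)] dk[OF D1(2,6,4)] Kd(3)[OF D1(6,6)] by auto
        show "p ` D \<inter> K = {}" "p ` D' \<inter> K = {}" using K(2) D1(1,2) by (auto simp: U_def)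
        show "(u, p m) \<notin> E" "u \<noteq> p m" using up[of m] pV(2)[of m] m by auto
      qed (use uv(1) K(2,3) UV tK[OF uT] tK[OF m(3)] in auto)
      show ?thesis
        using side[of ?A' ?A] side[of ?A ?A'] i m by (cases "i < m") auto
    next
      case False
      \<comment> \<open>Without inner attachments only \<open>u\<close> and its two neighbours on
        the hole remain. With \<open>p 0\<close> and \<open>p n\<close> as cut vertices, the short
        arc \<open>{u}\<close> plays the role of \<open>Z\<close>.\<close>
      have sub: "T \<subseteq> {u, p 0, p n}"
      proof
        fix t assume t: "t \<in> T"
        then consider "t = u" | i where "t = p i" "i \<le> n" using TU by (auto simp: U_def)
        then show "t \<in> {u, p 0, p n}"
        proof cases
          case 2
          then have "\<not> (0 < i \<and> i < n)" using False t by metis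
          then have "i = 0 \<or> i = n" using 2(2) by linarith
          then show ?thesis using 2 by auto
        qed simp
      qed
      moreover have "card {u, p 0, p n} \<le> card T" using T3 by (auto simp: card_insert_if)
      ultimately have T: "T = {u, p 0, p n}" by (intro card_seteq) auto
      let ?P = "p ` {1..n - 1}"
      have D: "{1..n - 1} \<subseteq> {..n}" "0 \<notin> {1..n - 1}" "n \<notin> {1..n - 1}" using n by auto
      show ?thesis
      proof (rule theta[of "p 0" "p n" ?P "{u}" K])
        show "conn_set E ?P" using arc[of 1 "n - 1"] n by simp
        show "touching E ?P {p 0}"
          unfolding tp[OF D(1) le0 D(2)] using n by (intro bexI[of _ 1]) auto
        show "touching E ?P {p n}"
          unfolding tp[OF D(1) order_refl D(3)] using n by (intro bexI[of _ "n - 1"]) auto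
        show "\<not> touching E ?P {u}" unfolding s[of _ "{u}"] tup[OF D(1)] using n by auto
        show "touching E {u} {p 0}" "touching E {u} {p n}" using tup[of "{0}"] tup[of "{n}"] by auto
        show "p 0 \<notin> ?P \<union> {u} \<union> K" "p n \<notin> ?P \<union> {u} \<union> K"
          using dk[OF D(1) le0 D(2)] dk[OF D(1) order_refl D(3)] pV(2)[of 0] pV(2)[of n]
            Kd(3)[of n 0] Kd(3)[of n n] by auto
        show "?P \<inter> K = {}" "{u} \<inter> K = {}" "?P \<inter> {u} = {}" "?P \<subseteq> V"
          using K(2) D(1) pV(1) du[OF D(1)] Kd(1)[OF diff_le_self, of 1 1]
          by (auto simp: U_def)
        show "p 0 \<noteq> p n" "(p 0, p n) \<notin> E" using peq[of 0 n] adj[of 0 n] n by auto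
        show "p 0 \<in> V" "p n \<in> V" using pV(1) by auto
        show "touching E {u} K" using tuK T by simp
        show "touching E K {p 0}" "touching E K {p n}" using tK T by auto
      qed (use uv(1) K(2,3) UV in auto)
    qed
  qed
qed

section \<open>Virtual edges\<close>

lemma conn_set_cong:
  "Restr E V = Restr E' V \<Longrightarrow> A \<subseteq> V \<Longrightarrow> conn_set E A \<longleftrightarrow> conn_set E' A"
  by (subgoal_tac "Restr E A = Restr E' A") (simp add: conn_set_def, blast)

lemma touching_cong:
  "Restr E V = Restr E' V \<Longrightarrow> A \<subseteq> V \<Longrightarrow> B \<subseteq> V \<Longrightarrow> touching E A B \<longleftrightarrow> touching E' A B"
  unfolding touching_def by blast

lemma minor_model_cong:
  assumes "Restr E V = Restr E' V"
  shows "minor_model H V E M \<longleftrightarrow> minor_model H V E' M"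
  using conn_set_cong[OF assms] touching_cong[OF assms] unfolding minor_model_def by meson

lemma minor_model_mono: "minor_model H V E M \<Longrightarrow> V \<subseteq> V' \<Longrightarrow> minor_model H V' E M"
  unfolding minor_model_def by blast

text \<open>The edge \<open>ab\<close> is simulated by a connected set \<open>C\<close> beyond
  \<open>V1\<close>: the branch set containing \<open>a\<close>, if there is one, absorbs
  \<open>C\<close> and thereby reaches \<open>b\<close>. No other adjacency arises, since
  \<open>a\<close> and \<open>b\<close> are the only possible neighbours of \<open>C\<close> in
  \<open>V1\<close>.\<close>

lemma minor_model_torso:
  assumes model: "minor_model H V1 E1 M"
    and V: "V1 \<subseteq> V" "C \<subseteq> V - V1" and "sym E2"
    and E: "Restr E1 V1 = Restr E2 V1 \<union> {(a, b), (b, a)}"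
    and C: "conn_set E2 C" "touching E2 C {a}" "touching E2 C {b}"
    and nC: "\<And>c x. c \<in> C \<Longrightarrow> x \<in> V1 \<Longrightarrow> (c, x) \<in> E2 \<Longrightarrow> x = a \<or> x = b"
  shows "\<exists>M'. minor_model H V E2 M'"
proof
  define M' where "M' = (\<lambda>i. M i \<union> (if a \<in> M i then C else {}))"
  have nC': "x = a \<or> x = b" if "c \<in> C" "x \<in> V1" "(x, c) \<in> E2" for c x
    using nC[OF that(1,2)] that(3) \<open>sym E2\<close> by (auto dest: symD)
  have ab: "a \<in> V1" "b \<in> V1" "(a, b) \<in> E1" "(b, a) \<in> E1" using E by blast+
  have E1: "(x, y) \<in> E1 \<longleftrightarrow> (x, y) \<in> E2 \<or> x = a \<and> y = b \<or> x = b \<and> y = a" if "x \<in> V1" "y \<in> V1" for x y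
  proof -
    have "(x, y) \<in> Restr E1 V1 \<longleftrightarrow> (x, y) \<in> Restr E2 V1 \<union> {(a, b), (b, a)}" using E by simp
    then show ?thesis using that by blast
  qed
  have aC: "touching E2 {a} C" using C(2) touching_sym[OF \<open>sym E2\<close>] by metis
  have caC: "conn_set E2 ({a} \<union> C)" using C aC by (intro conn_set_Un \<open>sym E2\<close>) auto
  have "conn_set E2 ({a} \<union> C \<union> {b})"
    using touching_mono[OF C(3), of "{a} \<union> C" "{b}"]
    by (intro conn_set_Un[OF \<open>sym E2\<close> caC]) auto
  show "minor_model H V E2 M'"
    unfolding minor_model_def
  proof (intro conjI ballI impI)
    fix i assume i: "i \<in> pverts H"
    then have Mi: "M i \<subseteq> V1" "conn_set E1 (M i)" using model by (auto simp: minor_model_def)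
    then show "M' i \<subseteq> V" using V by (auto simp: M'_def)
    show "conn_set E2 (M' i)"
    proof (cases "a \<in> M i")
      case False
      then have "Restr E1 (M i) = Restr E2 (M i)" using E1 Mi(1) by blast
      then show ?thesis using Mi(2) conn_set_cong[of E1 "M i" E2 "M i"] False by (simp add: M'_def)
    next
      case True
      then have M': "M' i = M i \<union> C" by (simp add: M'_def)
      \<comment> \<open>If the edge \<open>ab\<close> is used inside a branch set, it is replaced by
        a walk through \<open>C\<close>.\<close>
      have step: "(y, z) \<in> (Restr E2 (M i \<union> C))\<^sup>*" if "(y, z) \<in> Restr E1 (M i)" for y z
      proof (cases "(y, z) \<in> E2")
        case True then show ?thesis using that by auto
      next
        case False
        then have "y = a \<and> z = b \<or> y = b \<and> z = a" using that E1[of y z] Mi(1) by auto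
        then show ?thesis
          using that by (intro conn_setD[OF \<open>conn_set E2 ({a} \<union> C \<union> {b})\<close>]) auto
      qed
      have "(a, x) \<in> (Restr E2 (M i \<union> C))\<^sup>*" if "x \<in> M i \<union> C" for x
      proof (cases "x \<in> C")
        case True
        then show ?thesis using \<open>a \<in> M i\<close> by (intro conn_setD[OF caC]) auto
      next
        case False
        then have "(a, x) \<in> (Restr E1 (M i))\<^sup>*"
          using that Mi(2) \<open>a \<in> M i\<close> by (auto simp: conn_set_def)
        then show ?thesis
          by induction (auto intro: rtrancl_trans step)
      qed
      then show ?thesis unfolding M' using True by (intro conn_setI_root[of E2 a] \<open>sym E2\<close>) auto
    qed
  next
    fix i j assume ij: "i \<in> pverts H" "j \<in> pverts H" "i \<noteq> j"
    then have M: "M i \<subseteq> V1" "M j \<subseteq> V1" "M i \<inter> M j = {}"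
      "touching E1 (M i) (M j) \<longleftrightarrow> (i, j) \<in> parcs H"
      using model by (auto simp: minor_model_def)
    show "M' i \<inter> M' j = {}" using M V by (auto simp: M'_def)
    have "touching E2 (M' i) (M' j) \<longleftrightarrow> touching E1 (M i) (M j)"
    proof
      assume "touching E2 (M' i) (M' j)"
      then obtain x y where xy: "x \<in> M' i" "y \<in> M' j" "(x, y) \<in> E2" by (auto simp: touching_def)
      \<comment> \<open>An edge leaving \<open>C\<close> for the other branch set can only end in
        \<open>b\<close>, because \<open>a\<close> belongs to the set that absorbed
        \<open>C\<close>.\<close>
      consider "x \<in> M i" "y \<in> M j" | "x \<in> C" "a \<in> M i" "y \<in> M j" | "x \<in> M i" "a \<in> M j" "y \<in> C"
        using xy(1,2) M(3) by (auto simp: M'_def split: if_splits)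
      then show "touching E1 (M i) (M j)"
      proof cases
        case 1
        then have "(x, y) \<in> E1" using E1[of x y] xy(3) M by blast
        then show ?thesis using 1 by (auto simp: touching_def)
      next
        case 2
        then have "y = b" using nC[of x y] xy(3) M by blast
        then show ?thesis using 2 ab by (auto simp: touching_def)
      next
        case 3
        then have "x = b" using nC'[of y x] xy(3) M by blast
        then show ?thesis using 3 ab by (auto simp: touching_def)
      qed
    next
      assume "touching E1 (M i) (M j)"
      then obtain x y where xy: "x \<in> M i" "y \<in> M j" "(x, y) \<in> E1" by (auto simp: touching_def)
      have sub: "M i \<subseteq> M' i" "M j \<subseteq> M' j" by (auto simp: M'_def)
      consider "(x, y) \<in> E2" | "x = a" "y = b" | "x = b" "y = a"
        using E1[of x y] xy M by blast
      then show "touching E2 (M' i) (M' j)"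
      proof cases
        case 1 then show ?thesis using xy sub by (auto simp: touching_def)
      next
        case 2
        then show ?thesis using C(3) xy by (auto simp: touching_def M'_def)
      next
        case 3
        have "touching E2 {b} C" using C(3) touching_sym[OF \<open>sym E2\<close>] by metis
        then show ?thesis using 3 xy by (auto simp: touching_def M'_def)
      qed
    qed
    then show "touching E2 (M' i) (M' j) \<longleftrightarrow> (i, j) \<in> parcs H" using M(4) by simp
  qed
qed

text \<open>
  Edges in \<open>F\<close> are virtual: they may be kept or dropped at will, which models the choice between
  contracting and deleting what lies behind a separation of order two.
\<close>

definition W4_free_with :: "'a set \<Rightarrow> 'a rel \<Rightarrow> 'a rel \<Rightarrow> bool" where
  "W4_free_with V E F \<longleftrightarrow> (\<forall>F'. F' \<subseteq> F \<and> sym F' \<longrightarrow> \<not> (\<exists>M. minor_model W4 V (E \<union> F') M))"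

lemma W4_free_with_mono: "W4_free_with V E F \<Longrightarrow> V' \<subseteq> V \<Longrightarrow> W4_free_with V' E F"
  unfolding W4_free_with_def using minor_model_mono[of W4 V' _ _ V] by meson

text \<open>A model using the new edge \<open>ab\<close> is turned into one without it by
  contracting a component of the other side, one using only old virtual edges merely has to be
  viewed in \<open>V\<close>.\<close>

lemma W4_free_with_torso:
  assumes "sym E" "sym F" "W4_free_with V E F"
    and sep: "separation V (E \<union> F) V1 V2" "V1 \<inter> V2 = {a, b}"
    and ab: "a \<noteq> b" "(a, b) \<notin> E \<union> F"
    and no_sep: "\<And>V1 V2. separation V (E \<union> F) V1 V2 \<Longrightarrow> \<not> clique_in (E \<union> F) (V1 \<inter> V2)"
  shows "W4_free_with V1 E (F \<union> {(a, b), (b, a)})"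
proof -
  let ?H = "E \<union> F"
  have symH: "sym ?H" using assms(1,2) by (rule sym_Un)
  obtain v where v: "v \<in> V2 - V1" using sep by (auto simp: separation_def)
  define C where "C = component ?H (V2 - V1) v"
  have C: "v \<in> C" "C \<subseteq> V2 - V1" "conn_set ?H C"
    using component_refl[of v ?H] component_subset[OF v] conn_set_component[OF symH v]
    by (auto simp: C_def)
  have V: "V1 \<union> V2 = V" "\<not> touching ?H (V1 - V2) (V2 - V1)"
    using sep(1) by (auto simp: separation_def)
  have nC: "x \<in> C \<or> x = a \<or> x = b" if c: "c \<in> C" "x \<in> V" "(c, x) \<in> ?H" for c x
  proof (cases "x \<in> V2")
    case True
    then show ?thesis
      using component_closed[OF v, of c ?H x] c sep(2) by (auto simp: C_def)
  next
    case False
    then have "x \<in> V1 - V2" "c \<in> V2 - V1" using V c C by auto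
    then show ?thesis using V(2) symD[OF symH c(3)] by (auto simp: touching_def)
  qed
  \<comment> \<open>If \<open>C\<close> missed one of \<open>a\<close> and \<open>b\<close>, the
    other would alone separate \<open>C\<close>, and a single vertex is a clique.\<close>
  have t: "touching ?H C {y}" if xy: "{x, y} = {a, b}" for x y
  proof (rule ccontr)
    assume "\<not> touching ?H C {y}"
    then have "nbrs ?H V C \<subseteq> {x}" using nC xy by (fastforce simp: nbrs_def touching_def)
    moreover have "C \<subseteq> V" "C \<noteq> {}" "{x} \<subseteq> V - C" "y \<in> V - C - {x}"
      using C V sep(2) xy ab(1) by auto
    ultimately show False
      using separation_nbrs[of C V ?H "{x}" y] no_sep[of "C \<union> {x}" "V - C"]
      by (simp add: clique_in_def)
  qed
  show ?thesis
    unfolding W4_free_with_def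
  proof (intro allI impI notI)
    fix F' assume F': "F' \<subseteq> F \<union> {(a, b), (b, a)} \<and> sym F'" and "\<exists>M. minor_model W4 V1 (E \<union> F') M"
    then obtain M where M: "minor_model W4 V1 (E \<union> F') M" by blast
    have V1: "V1 \<subseteq> V" "C \<subseteq> V - V1" using V C by auto
    show False
    proof (cases "(a, b) \<in> F'")
      case False
      then have "F' \<subseteq> F" using F' by (auto dest: symD)
      then show False using M minor_model_mono[OF M V1(1)] assms(3) F' by (auto simp: W4_free_with_def)
    next
      case True
      then have "(b, a) \<in> F'" using F' by (auto dest: symD)
      \<comment> \<open>Inside \<open>V1\<close> the choice \<open>F'\<close> is respected, with
        \<open>ab\<close> dropped since it is not in \<open>F\<close>. All other virtual edges are
        kept, so that \<open>C\<close> remains connected and attached to \<open>a\<close> and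
        \<open>b\<close>.\<close>
      define F'' where "F'' = {(p, q) \<in> F. p \<in> V1 \<and> q \<in> V1 \<longrightarrow> (p, q) \<in> F'}"
      have "sym F''" using F' \<open>sym F\<close> by (auto simp: F''_def sym_def)
      then have s: "sym (E \<union> F'')" using \<open>sym E\<close> by (intro sym_Un)
      have 1: "Restr (E \<union> F') V1 = Restr (E \<union> F'') V1 \<union> {(a, b), (b, a)}"
      proof -
        have "a \<in> V1" "b \<in> V1" using sep(2) by blast+
        then show ?thesis using F' True \<open>(b, a) \<in> F'\<close> unfolding F''_def by blast
      qed
      have 2: "Restr (E \<union> F'') C = Restr ?H C" using C by (auto simp: F''_def)
      have 3: "(c, x) \<in> E \<union> F'' \<longleftrightarrow> (c, x) \<in> ?H" if "c \<in> C" for c x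
        using that C by (auto simp: F''_def)
      have 4: "touching (E \<union> F'') C {y} \<longleftrightarrow> touching ?H C {y}" for y
        using 3 by (auto simp: touching_def)
      have "\<exists>M'. minor_model W4 V (E \<union> F'') M'"
      proof (rule minor_model_torso[OF M V1 s 1])
        show "conn_set (E \<union> F'') C" using conn_set_cong[OF 2] C(3) by simp
        show "touching (E \<union> F'') C {a}" "touching (E \<union> F'') C {b}"
          using t[of b a] t[of a b] 4 by (auto simp: insert_commute)
        show "x = a \<or> x = b" if "c \<in> C" "x \<in> V1" "(c, x) \<in> E \<union> F''" for c x
          using nC[of c x] that 3[of c x] V1 by auto
      qed
      moreover have "F'' \<subseteq> F" by (auto simp: F''_def)
      ultimately show False using assms(3) \<open>sym F''\<close> by (auto simp: W4_free_with_def)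
    qed
  qed
qed

lemma card_independent_in_clique_le:
  assumes "sym E" "sym F" "W4_free_with V E F" "clique_in (E \<union> F) V"
    and I: "I \<subseteq> V" "\<forall>x\<in>I. \<forall>y\<in>I. (x, y) \<notin> E"
  shows "card I \<le> 4"
proof (rule ccontr)
  assume "\<not> card I \<le> 4"
  then have "5 \<le> card I" by simp
  then obtain T where T: "T \<subseteq> I" "card T = 5" "finite T" by (rule obtain_subset_with_card_n)
  then obtain xs where xs: "set xs = T" "distinct xs" using finite_distinct_list by blast
  then have "length xs = 5" using T(2) distinct_card by fastforce
  then obtain a b c d e where "xs = [a, b, c, d, e]"
    by (auto simp: numeral_eq_Suc length_Suc_conv)
  then have dist: "distinct [a, b, c, d, e]" and abcde: "{a, b, c, d, e} \<subseteq> I" using xs T(1) by auto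
  have dist_rev: "distinct [e, d, c, b, a]" using dist by auto
  \<comment> \<open>On five such vertices every pair is a virtual edge. Dropping \<open>ac\<close>
    and \<open>bd\<close> leaves the rim \<open>a\<close>, \<open>b\<close>, \<open>c\<close>,
    \<open>d\<close> with hub \<open>e\<close>.\<close>
  define F' where "F' = F - {(a, c), (c, a), (b, d), (d, b)}"
  have "sym F'" using \<open>sym F\<close> by (auto simp: F'_def sym_def)
  have adj: "(x, y) \<in> E \<union> F' \<longleftrightarrow> (x, y) \<notin> {(a, c), (c, a), (b, d), (d, b)}"
    if "x \<in> {a, b, c, d, e}" "y \<in> {a, b, c, d, e}" "x \<noteq> y" for x y
  proof -
    have "x \<in> I" "y \<in> I" using that(1,2) abcde by blast+
    then have "(x, y) \<notin> E" "(x, y) \<in> F" using that(3) I assms(4) unfolding clique_in_def by blast+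
    then show ?thesis by (simp add: F'_def)
  qed
  then have t: "touching (E \<union> F') {x} {y} \<longleftrightarrow> (x, y) \<notin> {(a, c), (c, a), (b, d), (d, b)}"
    if "x \<in> {a, b, c, d, e}" "y \<in> {a, b, c, d, e}" "x \<noteq> y" for x y
    using that by (simp add: touching_def)
  have "{a, b, c, d, e} \<subseteq> V" using abcde I by blast
  then have "\<exists>M. minor_model W4 V (E \<union> F') M"
  proof (intro W4_modelI[of "E \<union> F'" "{a}" "{b}" "{c}" "{d}" "{e}"])
    show "sym (E \<union> F')" using \<open>sym E\<close> \<open>sym F'\<close> by (rule sym_Un)
  qed (use dist dist_rev in \<open>simp_all add: t\<close>)
  then show False using assms(3) \<open>sym F'\<close> by (auto simp: W4_free_with_def F'_def)
qed

section \<open>Trees of bags\<close>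

text \<open>Bags listed in an order in which each one is attached as a leaf to an earlier one.\<close>

inductive bag_tree :: "'a set list \<Rightarrow> bool" where
  single: "bag_tree [X]"
| snoc: "bag_tree Xs \<Longrightarrow> Y \<in> set Xs \<Longrightarrow> X \<inter> \<Union>(set Xs) \<subseteq> Y \<Longrightarrow> bag_tree (Xs @ [X])"

lemma bag_tree_nonempty: "bag_tree Xs \<Longrightarrow> Xs \<noteq> []"
  by (induction rule: bag_tree.induct) auto

text \<open>The first bag of \<open>Ys\<close> becomes a child of \<open>X\<close>. A later bag
  keeps its parent: whatever it shares with \<open>Xs\<close> lies in \<open>hd Ys\<close>, hence
  among the earlier bags of \<open>Ys\<close>.\<close>

lemma bag_tree_append:
  assumes "bag_tree Xs" "bag_tree Ys"
    and "X \<in> set Xs" "hd Ys \<inter> \<Union>(set Xs) \<subseteq> X" "\<Union>(set Xs) \<inter> \<Union>(set Ys) \<subseteq> hd Ys"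
  shows "bag_tree (Xs @ Ys)"
  using assms(2,4,5)
proof (induction rule: bag_tree.induct)
  case (single Y)
  then show ?case using bag_tree.snoc[OF assms(1,3)] by simp
next
  case (snoc Ys Y Z)
  have ne: "Ys \<noteq> []" using snoc.hyps(1) by (rule bag_tree_nonempty)
  then have "bag_tree (Xs @ Ys)" using snoc by auto
  have "hd Ys \<subseteq> \<Union>(set Ys)" using hd_in_set[OF ne] by blast
  moreover have "\<Union>(set Xs) \<inter> Z \<subseteq> hd Ys" using snoc.prems(2) ne by auto
  ultimately have "Z \<inter> \<Union>(set (Xs @ Ys)) \<subseteq> Y" using snoc.hyps(3) by (simp only: set_append) blast
  then have "bag_tree ((Xs @ Ys) @ [Z])"
    using \<open>bag_tree (Xs @ Ys)\<close> snoc.hyps(2) by (intro bag_tree.snoc[of _ Y]) auto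
  then show ?case by simp
qed

text \<open>The Helly property of subtrees, by removing the last bag. Pairs from earlier bags that
  share the last one also share its parent; a vertex occurring in the last bag only forces all of
  \<open>S\<close> into it.\<close>

lemma bag_tree_clique_in_bag:
  assumes "bag_tree Xs" "\<forall>x\<in>S. \<forall>y\<in>S. \<exists>X\<in>set Xs. x \<in> X \<and> y \<in> X"
  shows "\<exists>X\<in>set Xs. S \<subseteq> X"
  using assms
proof (induction rule: bag_tree.induct)
  case (single X)
  then show ?case by auto
next
  case (snoc Xs Y X)
  show ?case
  proof (cases "S \<subseteq> \<Union>(set Xs)")
    case True
    have "\<exists>X\<in>set Xs. x \<in> X \<and> y \<in> X" if xy: "x \<in> S" "y \<in> S" for x y
    proof -
      obtain X' where X': "X' \<in> set (Xs @ [X])" "x \<in> X'" "y \<in> X'" using snoc.prems xy by blast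
      show ?thesis
      proof (cases "X' = X")
        case True
        then have "x \<in> Y" "y \<in> Y" using X' xy snoc.hyps(3) \<open>S \<subseteq> \<Union>(set Xs)\<close> by auto
        then show ?thesis using snoc.hyps(2) by blast
      qed (use X' in auto)
    qed
    then show ?thesis using snoc.IH by auto
  next
    case False
    then obtain s where "s \<in> S" "s \<notin> \<Union>(set Xs)" by blast
    then have "x \<in> X" if "x \<in> S" for x
      using bspec[OF bspec[OF snoc.prems \<open>s \<in> S\<close>] that] by auto
    then show ?thesis by auto
  qed
qed

text \<open>Having \<open>K\<close> in the first bag allows attachment to another list along the
  clique \<open>K\<close>. Virtual edges are covered as well, so that separators turned into cliques
  fit into one bag, while independence is measured by the real edges \<open>E\<close>.\<close>

definition rooted_decomposition :: "'a rel \<Rightarrow> 'a rel \<Rightarrow> 'a set \<Rightarrow> 'a set \<Rightarrow> 'a set list \<Rightarrow> bool" where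
  "rooted_decomposition E F V K Xs \<longleftrightarrow>
     bag_tree Xs \<and> K \<subseteq> hd Xs \<and> \<Union>(set Xs) = V \<and>
     (\<forall>x\<in>V. \<forall>y\<in>V. (x, y) \<in> E \<union> F \<longrightarrow> (\<exists>X\<in>set Xs. x \<in> X \<and> y \<in> X)) \<and>
     (\<forall>X\<in>set Xs. \<forall>I\<subseteq>X. (\<forall>x\<in>I. \<forall>y\<in>I. (x, y) \<notin> E) \<longrightarrow> card I \<le> 4)"

lemma rooted_decomposition_append:
  assumes sep: "separation V (E \<union> F) V1 V2" and "sym E" "sym F"
    and clique: "clique_in (E \<union> F) (V1 \<inter> V2)"
    and Xs: "rooted_decomposition E F V1 K Xs"
    and Ys: "rooted_decomposition E F V2 (V1 \<inter> V2) Ys"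
  shows "rooted_decomposition E F V K (Xs @ Ys)"
proof -
  have X: "bag_tree Xs" "K \<subseteq> hd Xs" "\<Union>(set Xs) = V1"
    "\<And>x y. x \<in> V1 \<Longrightarrow> y \<in> V1 \<Longrightarrow> (x, y) \<in> E \<union> F \<Longrightarrow> \<exists>X\<in>set Xs. x \<in> X \<and> y \<in> X"
    using Xs unfolding rooted_decomposition_def by blast+
  have Y: "bag_tree Ys" "V1 \<inter> V2 \<subseteq> hd Ys" "\<Union>(set Ys) = V2"
    "\<And>x y. x \<in> V2 \<Longrightarrow> y \<in> V2 \<Longrightarrow> (x, y) \<in> E \<union> F \<Longrightarrow> \<exists>X\<in>set Ys. x \<in> X \<and> y \<in> X"
    using Ys unfolding rooted_decomposition_def by blast+
  have V: "V1 \<union> V2 = V" "\<not> touching (E \<union> F) (V1 - V2) (V2 - V1)"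
    using sep by (auto simp: separation_def)
  have ne: "Xs \<noteq> []" "Ys \<noteq> []" using bag_tree_nonempty[OF X(1)] bag_tree_nonempty[OF Y(1)] by auto
  have "\<exists>X\<in>set Xs. x \<in> X \<and> y \<in> X" if "x \<in> V1 \<inter> V2" "y \<in> V1 \<inter> V2" for x y
  proof (cases "x = y")
    case True then show ?thesis using X(3) that by blast
  next
    case False then show ?thesis using X(4) that clique by (auto simp: clique_in_def)
  qed
  \<comment> \<open>The Helly property supplies the bag of \<open>Xs\<close> to which the root of
    \<open>Ys\<close>, which also contains the separator, is attached.\<close>
  then obtain B where B: "B \<in> set Xs" "V1 \<inter> V2 \<subseteq> B"
    using bag_tree_clique_in_bag[OF X(1), of "V1 \<inter> V2"] by blast
  have "hd Ys \<subseteq> V2" using hd_in_set[OF ne(2)] Y(3) by blast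
  then have "bag_tree (Xs @ Ys)"
    using B X Y by (intro bag_tree_append[of Xs Ys B]) auto
  moreover have "\<exists>X\<in>set (Xs @ Ys). x \<in> X \<and> y \<in> X" if xy: "x \<in> V" "y \<in> V" "(x, y) \<in> E \<union> F" for x y
  proof -
    have "(y, x) \<in> E \<union> F" using symD[OF sym_Un[OF assms(2,3)] xy(3)] .
    then have "\<not> (x \<in> V1 - V2 \<and> y \<in> V2 - V1)" "\<not> (y \<in> V1 - V2 \<and> x \<in> V2 - V1)"
      using xy(3) V(2) unfolding touching_def by meson+
    then have "x \<in> V1 \<and> y \<in> V1 \<or> x \<in> V2 \<and> y \<in> V2" using xy(1,2) V(1) by auto
    then show ?thesis using X(4)[of x y] Y(4)[of x y] xy(3) by auto
  qed
  moreover have "\<forall>X\<in>set (Xs @ Ys). \<forall>I\<subseteq>X. (\<forall>x\<in>I. \<forall>y\<in>I. (x, y) \<notin> E) \<longrightarrow> card I \<le> 4"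
    using Xs Ys by (simp add: rooted_decomposition_def ball_Un)
  moreover have "\<Union>(set (Xs @ Ys)) = V" "K \<subseteq> hd (Xs @ Ys)"
    using X(2,3) Y(3) V(1) ne by simp_all
  ultimately show ?thesis
    unfolding rooted_decomposition_def by blast
qed

text \<open>Induction on the number of vertices. \<open>F\<close> varies because cuts of order two
  add virtual edges, and \<open>K\<close> varies because the second part must be rooted at the
  separator.\<close>

lemma rooted_decomposition_exists:
  assumes "finite V" "sym E" "sym F" "W4_free_with V E F" "K \<subseteq> V" "clique_in (E \<union> F) K"
  shows "\<exists>Xs. rooted_decomposition E F V K Xs"
  using assms
proof (induction "card V" arbitrary: V F K rule: less_induct)
  case less
  note symE = \<open>sym E\<close>
  \<comment> \<open>Both kinds of cut end here: \<open>F'\<close> is \<open>F\<close> for a clique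
    separator, and \<open>F\<close> with one new edge for a separator of order two.\<close>
  have glue: "\<exists>Xs. rooted_decomposition E F' V K Xs"
    if sep: "separation V (E \<union> F') V1 V2" and cl: "clique_in (E \<union> F') (V1 \<inter> V2)"
      and F': "sym F'" "F \<subseteq> F'" and free: "W4_free_with V1 E F'" "W4_free_with V2 E F'"
    for F' V1 V2
  proof -
    have symH: "sym (E \<union> F')" using symE F'(1) by (rule sym_Un)
    have K: "clique_in (E \<union> F') K" using less.prems(6) F'(2) by (auto simp: clique_in_def)
    have one: ?thesis if sep': "separation V (E \<union> F') U1 U2" and cl': "clique_in (E \<union> F') (U1 \<inter> U2)"
      and free': "W4_free_with U1 E F'" "W4_free_with U2 E F'" and KU: "K \<subseteq> U1" for U1 U2
    proof -
      have U: "U1 \<subset> V" "U2 \<subset> V" using sep' by (auto simp: separation_def)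
      then have c: "card U1 < card V" "card U2 < card V" "finite U1" "finite U2"
        using psubset_card_mono[OF less.prems(1)] finite_subset[OF _ less.prems(1)] by auto
      obtain Xs where Xs: "rooted_decomposition E F' U1 K Xs"
        using less.hyps[OF c(1) c(3) symE F'(1) free'(1) KU K] by blast
      obtain Ys where Ys: "rooted_decomposition E F' U2 (U1 \<inter> U2) Ys"
        using less.hyps[OF c(2) c(4) symE F'(1) free'(2) _ cl'] by blast
      show ?thesis
        using rooted_decomposition_append[OF sep' symE F'(1) cl' Xs Ys] by blast
    qed
    \<comment> \<open>The clique \<open>K\<close> cannot have vertices strictly on both sides. The
      side containing it is decomposed first and keeps \<open>K\<close> in its root.\<close>
    have "K \<subseteq> V1 \<or> K \<subseteq> V2"
    proof (rule ccontr)
      assume "\<not> ?thesis"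
      then obtain x y where xy: "x \<in> K" "x \<notin> V2" "y \<in> K" "y \<notin> V1" by blast
      then have "x \<in> V1 - V2" "y \<in> V2 - V1"
        using less.prems(5) sep by (auto simp: separation_def)
      moreover from this have "(x, y) \<in> E \<union> F'" using K xy by (auto simp: clique_in_def)
      ultimately show False using sep unfolding separation_def touching_def by blast
    qed
    then show ?thesis
      using one[OF sep cl free] one[OF separation_sym[OF symH sep] _ free(2,1)] cl
      by (auto simp: Int_commute)
  qed
  let ?H = "E \<union> F"
  have symH: "sym ?H" using symE less.prems(3) by (rule sym_Un)
  show ?case
  proof (cases "clique_in ?H V")
    case True
    then have "rooted_decomposition E F V K [V]"
      using card_independent_in_clique_le[OF symE less.prems(3,4) True] less.prems(5)
      by (auto simp: rooted_decomposition_def intro: bag_tree.single)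
    then show ?thesis by blast
  next
    case not_clique: False
    show ?thesis
    proof (cases "\<exists>V1 V2. separation V ?H V1 V2 \<and> clique_in ?H (V1 \<inter> V2)")
      case True
      then obtain V1 V2 where sep: "separation V ?H V1 V2" "clique_in ?H (V1 \<inter> V2)" by blast
      then have "V1 \<subseteq> V" "V2 \<subseteq> V" by (auto simp: separation_def)
      then show ?thesis
        using glue[OF sep less.prems(3) order_refl] W4_free_with_mono[OF less.prems(4)] by blast
    next
      case False
      then have no_sep: "\<not> clique_in ?H (V1 \<inter> V2)" if "separation V ?H V1 V2" for V1 V2
        using that by blast
      have "\<not> (\<exists>M. minor_model W4 V ?H M)"
        using less.prems(3,4) by (auto simp: W4_free_with_def)
      then have "\<not> (\<forall>V1 V2. separation V ?H V1 V2 \<longrightarrow> 3 \<le> card (V1 \<inter> V2) \<and> \<not> clique_in ?H (V1 \<inter> V2))"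
        using W4_model_of_no_small_separation[OF symH less.prems(1) _ not_clique] by blast
      then obtain V1 V2 where sep: "separation V ?H V1 V2" and c: "card (V1 \<inter> V2) < 3"
        using no_sep by force
      obtain a b where ab: "a \<in> V1 \<inter> V2" "b \<in> V1 \<inter> V2" "a \<noteq> b" "(a, b) \<notin> ?H"
        using no_sep[OF sep] by (auto simp: clique_in_def)
      have fin: "finite (V1 \<inter> V2)" using sep less.prems(1) by (auto simp: separation_def)
      have "card {a, b} \<le> card (V1 \<inter> V2)" using ab fin by (intro card_mono) auto
      \<comment> \<open>A separator with fewer than three vertices that is not a clique consists of
        exactly two nonadjacent vertices.\<close>
      then have S: "V1 \<inter> V2 = {a, b}"
        using ab fin c card_seteq[OF fin, of "{a, b}"] by auto
      let ?F = "F \<union> {(a, b), (b, a)}"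
      have free: "W4_free_with V1 E ?F" "W4_free_with V2 E ?F"
        using W4_free_with_torso[OF symE less.prems(3,4) sep S ab(3,4) no_sep]
          W4_free_with_torso[OF symE less.prems(3,4) separation_sym[OF symH sep] _ ab(3,4) no_sep] S
        by (auto simp: Int_commute)
      have "\<not> touching (E \<union> ?F) (V1 - V2) (V2 - V1)"
        using sep ab(1,2) by (auto simp: separation_def touching_def)
      then have sep': "separation V (E \<union> ?F) V1 V2"
        using sep by (simp add: separation_def)
      have "sym ?F" using less.prems(3) by (auto simp: sym_def)
      then obtain Xs where "rooted_decomposition E ?F V K Xs"
        using glue[OF sep' _ _ _ free] S by (auto simp: clique_in_def)
      \<comment> \<open>Forgetting the new virtual edge only weakens the covering condition.\<close>
      then have "rooted_decomposition E F V K Xs"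
        unfolding rooted_decomposition_def by blast
      then show ?thesis by blast
    qed
  qed
qed

section \<open>From bag trees to tree decompositions\<close>

lemma connected_induced_if_conn_set:
  assumes "conn_set (parcs T) A"
  shows "connected (with_proj T \<restriction> A)"
proof -
  let ?S = "mk_symmetric (with_proj T \<restriction> A)"
  have "(x, y) \<in> rtrancl_on A (parcs ?S)" if "(x, y) \<in> (Restr (parcs T) A)\<^sup>*" "x \<in> A" for x y
    using that
  proof induction
    case (step y z)
    then have "(y, z) \<in> parcs ?S" by (auto simp: mk_symmetric_def induce_subgraph_def)
    then show ?case using step by (auto intro: rtrancl_on_into_rtrancl_on)
  qed auto
  then show ?thesis
    using assms unfolding connected_def strongly_connected_def reachable_def conn_set_def
    by (simp add: mk_symmetric_def)
qed

text \<open>A form of cycles accessible by cyclic indices. Traversing one edge forth and back also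
  qualifies, which is why only tours of length at least three are excluded later.\<close>

definition closed_tour :: "'a rel \<Rightarrow> ('a \<times> 'a) list \<Rightarrow> bool" where
  "closed_tour E p \<longleftrightarrow> set p \<subseteq> E \<and> distinct (map snd p) \<and>
     (\<forall>i<length p. snd (p ! i) = fst (p ! (Suc i mod length p)))"

lemma closed_tour_if_cycle:
  assumes "pre_digraph.cycle (with_proj T) p"
  shows "closed_tour (parcs T) p"
proof -
  obtain u where u: "pre_digraph.awalk (with_proj T) u p u"
      "distinct (tl (pre_digraph.awalk_verts (with_proj T) u p))" "p \<noteq> []"
    using assms by (auto simp: pre_digraph.cycle_def)
  then have c: "pre_digraph.cas (with_proj T) u p u" "set p \<subseteq> parcs T"
    by (auto simp: pre_digraph.awalk_def)
  have "distinct (map snd p)"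
    using u(2,3) pre_digraph.awalk_verts_conv'[OF c(1)] by simp
  have *: "(\<forall>i. Suc i < length p \<longrightarrow> snd (p ! i) = fst (p ! Suc i)) \<and>
      (p \<noteq> [] \<longrightarrow> fst (p ! 0) = u \<and> snd (p ! (length p - 1)) = v)"
    if "pre_digraph.cas (with_proj T) u p v" for u v p
    using that
  proof (induction p arbitrary: u)
    case (Cons e p)
    then show ?case
      by (cases p) (auto simp: pre_digraph.cas.simps nth_Cons split: nat.splits)
  qed simp
  have "snd (p ! i) = fst (p ! (Suc i mod length p))" if "i < length p" for i
  proof (cases "Suc i < length p")
    case True then show ?thesis using *[OF c(1)] by simp
  next
    case False
    then have "Suc i = length p" using that by simp
    then show ?thesis using *[OF c(1)] u(3) by (metis diff_Suc_1 mod_self)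
  qed
  then show ?thesis using c(2) \<open>distinct (map snd p)\<close> by (simp add: closed_tour_def)
qed

text \<open>The two edges of a cycle of length at least three at a leaf would coincide.\<close>

lemma closed_tour_leaf:
  assumes "closed_tour (E \<union> {(s, t), (t, s)}) p" "3 \<le> length p"
    and "E \<subseteq> V \<times> V" "s \<in> V" "t \<notin> V"
  shows "closed_tour E p"
proof -
  let ?E = "E \<union> {(s, t), (t, s)}" and ?n = "length p"
  have p: "set p \<subseteq> ?E" "distinct (map snd p)"
    and succ: "\<And>i. i < ?n \<Longrightarrow> snd (p ! i) = fst (p ! (Suc i mod ?n))"
    using assms(1) by (auto simp: closed_tour_def)
  have into: "p ! i \<noteq> (s, t)" if i: "i < ?n" for i
  proof
    assume pi: "p ! i = (s, t)"
    \<comment> \<open>\<open>j\<close> and \<open>h\<close> are the cyclic successor and predecessor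
      of \<open>i\<close>; adding \<open>?n\<close> before subtracting avoids truncation at
      \<open>i = 0\<close>. The successor of \<open>(s, t)\<close> must return to \<open>s\<close>,
      the head of the predecessor, so both coincide, impossible for length at least three.\<close>
    define j where "j = Suc i mod ?n"
    define h where "h = (i + ?n - 1) mod ?n"
    have jn: "j < ?n" and hn: "h < ?n"
      using assms(2) by (auto simp: j_def h_def intro!: mod_less_divisor)
    have hi: "Suc h mod ?n = i"
    proof -
      have "Suc h mod ?n = Suc (i + ?n - 1) mod ?n" unfolding h_def by (rule mod_Suc_eq)
      also have "Suc (i + ?n - 1) = i + ?n" using assms(2) by simp
      finally show ?thesis using i by simp
    qed
    have "fst (p ! j) = t" using succ[OF i] pi by (simp add: j_def)
    moreover have "p ! j \<in> ?E" using p(1) nth_mem[OF jn] by blast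
    ultimately have "snd (p ! j) = s"
      using assms(3-5) by (cases "p ! j") auto
    moreover have "snd (p ! h) = s" using succ[OF hn] hi pi by simp
    moreover have "snd (p ! i) = t" using pi by simp
    moreover have "snd (p ! h) \<noteq> snd (p ! j)"
    proof
      assume "snd (p ! h) = snd (p ! j)"
      then have "h = j" using p(2) hn jn by (auto simp: distinct_conv_nth)
      then have "Suc (Suc i mod ?n) mod ?n = i" using hi j_def by simp
      then have "Suc (Suc i) mod ?n = i" by (simp add: mod_Suc_eq)
      then show False using i assms(2)
        by (cases "Suc (Suc i) < ?n"; cases "Suc i = ?n"; auto simp: mod_if split: if_splits)
    qed
    ultimately show False by auto
  qed
  \<comment> \<open>An arc leaving \<open>t\<close> is preceded by one entering \<open>t\<close>,
    and that can only be the excluded \<open>(s, t)\<close>.\<close>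
  have "p ! i \<noteq> (t, s)" if i: "i < ?n" for i
  proof
    assume pi: "p ! i = (t, s)"
    define h where "h = (i + ?n - 1) mod ?n"
    have hn: "h < ?n" using assms(2) by (auto simp: h_def intro!: mod_less_divisor)
    have "Suc h mod ?n = Suc (i + ?n - 1) mod ?n" unfolding h_def by (rule mod_Suc_eq)
    also have "Suc (i + ?n - 1) = i + ?n" using assms(2) by simp
    finally have "snd (p ! h) = t" using succ[OF hn] i pi by simp
    moreover have "p ! h \<in> ?E" using p(1) nth_mem[OF hn] by blast
    ultimately have "p ! h = (s, t)" using assms(3-5) into[OF hn] by (cases "p ! h") auto
    then show False using into[OF hn] by simp
  qed
  then have "set p \<subseteq> E" using into p(1) by (fastforce simp: in_set_conv_nth)
  then show ?thesis using assms(1) by (simp add: closed_tour_def)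
qed

section \<open>Trees and tree decompositions from lists of bags\<close>

lemma conn_set_mono_rel: "conn_set E A \<Longrightarrow> E \<subseteq> E' \<Longrightarrow> conn_set E' A"
  unfolding conn_set_def using rtrancl_mono[of "Restr E A" "Restr E' A"] by blast

lemma undirected_treeI:
  assumes "pair_graph T" "conn_set (parcs T) (pverts T)"
    and "\<And>p. 3 \<le> length p \<Longrightarrow> \<not> closed_tour (parcs T) p"
  shows "undirected_tree T"
proof -
  have "parcs T \<subseteq> pverts T \<times> pverts T" using assms(1) by (simp add: pair_graph_iff)
  then have "with_proj T \<restriction> pverts T = with_proj T"
    by (auto simp: induce_subgraph_def with_proj_def)
  then have "connected (with_proj T)"
    using connected_induced_if_conn_set[OF assms(2)] by simp
  then show ?thesis
    using assms(1,3) closed_tour_if_cycle by (auto simp: undirected_tree_def)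
qed

text \<open>Node \<open>t\<close> carries the bag \<open>Xs ! t\<close>, and a new bag becomes a
  leaf at the position \<open>s\<close> of its parent. An old vertex in the new bag also lies in the
  parent bag, so its set of nodes stays connected.\<close>

lemma tree_of_bag_tree:
  assumes "bag_tree Xs"
  shows "\<exists>T :: nat pair_pre_digraph. pverts T = {..<length Xs} \<and> pair_graph T \<and>
    conn_set (parcs T) (pverts T) \<and> (\<forall>p. 3 \<le> length p \<longrightarrow> \<not> closed_tour (parcs T) p) \<and>
    (\<forall>u\<in>\<Union>(set Xs). conn_set (parcs T) {t \<in> pverts T. u \<in> Xs ! t})"
  using assms
proof (induction rule: bag_tree.induct)
  case (single X)
  have 1: "{t. t = 0 \<and> P t} = {0}" if "P 0" for P :: "nat \<Rightarrow> bool" using that by auto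
  show ?case
    by (rule exI[of _ "\<lparr>pverts = {0}, parcs = {}\<rparr>"])
      (auto simp: pair_graph_iff sym_def irrefl_def closed_tour_def 1)
next
  case (snoc Xs Y X)
  then obtain T :: "nat pair_pre_digraph" where T: "pverts T = {..<length Xs}" "pair_graph T"
    "conn_set (parcs T) (pverts T)" "\<And>p. 3 \<le> length p \<Longrightarrow> \<not> closed_tour (parcs T) p"
    "\<And>u. u \<in> \<Union>(set Xs) \<Longrightarrow> conn_set (parcs T) {t \<in> pverts T. u \<in> Xs ! t}" by blast
  obtain s where s: "s < length Xs" "Xs ! s = Y" using snoc.hyps(2) by (auto simp: in_set_conv_nth)
  let ?n = "length Xs"
  define T' where "T' = \<lparr>pverts = {..<Suc ?n}, parcs = parcs T \<union> {(s, ?n), (?n, s)}\<rparr>"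
  have PT: "parcs T \<subseteq> {..<?n} \<times> {..<?n}" "sym (parcs T)" "irrefl (parcs T)"
    using T(1,2) by (auto simp: pair_graph_iff)
  have sym': "sym (parcs T')" using PT(2) by (auto simp: T'_def sym_def)
  have pg: "pair_graph T'"
    unfolding pair_graph_iff using PT s sym' by (auto simp: T'_def irrefl_def)
  have sub: "parcs T \<subseteq> parcs T'" by (auto simp: T'_def)
  have add: "conn_set (parcs T') (A \<union> {?n})" if "conn_set (parcs T) A" "s \<in> A" for A
    using that conn_set_mono_rel[OF that(1) sub]
    by (intro conn_set_Un sym') (auto simp: touching_def T'_def)
  have conn: "conn_set (parcs T') (pverts T')"
    using add[OF T(3)] s by (simp add: T(1) T'_def lessThan_Suc)
  have cyc: "\<not> closed_tour (parcs T') p" if "3 \<le> length p" for p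
    using closed_tour_leaf[of "parcs T" s ?n p "{..<?n}"] T(4)[OF that] that PT(1) s
    by (auto simp: T'_def)
  have sub: "conn_set (parcs T') {t \<in> pverts T'. u \<in> (Xs @ [X]) ! t}"
    if u: "u \<in> \<Union>(set (Xs @ [X]))" for u
  proof -
    let ?A = "{t \<in> pverts T. u \<in> Xs ! t}"
    have eq: "{t \<in> pverts T'. u \<in> (Xs @ [X]) ! t} = ?A \<union> (if u \<in> X then {?n} else {})"
      by (auto simp: T'_def T(1) nth_append less_Suc_eq)
    show ?thesis
    proof (cases "u \<in> \<Union>(set Xs)")
      case True
      note A = T(5)[OF True]
      show ?thesis
      proof (cases "u \<in> X")
        case True
        then have "s \<in> ?A" using s snoc.hyps(3) \<open>u \<in> \<Union>(set Xs)\<close> T(1) by auto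
        then show ?thesis using add[OF A] True eq by simp
      next
        case False
        then show ?thesis using conn_set_mono_rel[OF A sub] eq by simp
      qed
    next
      case False
      then have "?A = {}" using T(1) nth_mem by auto
      moreover have "u \<in> X" using u False by auto
      ultimately show ?thesis
        unfolding eq by (simp only: Un_empty_left if_True conn_set_singleton)
    qed
  qed
  show ?case
    by (rule exI[of _ T']) (use pg conn cyc sub in \<open>auto simp: T'_def\<close>)
qed

lemma tree_decomposition_of_bag_tree:
  assumes "bag_tree Xs" "\<Union>(set Xs) = pverts G"
    and "\<And>x y. (x, y) \<in> parcs G \<Longrightarrow> \<exists>X\<in>set Xs. x \<in> X \<and> y \<in> X"
  obtains T :: "nat pair_pre_digraph" where "pverts T = {..<length Xs}"
    "tree_decomposition G T (\<lambda>t. Xs ! t)"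
proof -
  obtain T :: "nat pair_pre_digraph" where T: "pverts T = {..<length Xs}" "pair_graph T"
    "conn_set (parcs T) (pverts T)" "\<And>p. 3 \<le> length p \<Longrightarrow> \<not> closed_tour (parcs T) p"
    "\<And>u. u \<in> \<Union>(set Xs) \<Longrightarrow> conn_set (parcs T) {t \<in> pverts T. u \<in> Xs ! t}"
    using tree_of_bag_tree[OF assms(1)] by blast
  have nth: "(\<exists>X\<in>set Xs. P X) \<longleftrightarrow> (\<exists>t\<in>pverts T. P (Xs ! t))" for P
    using nth_mem by (fastforce simp: T(1) in_set_conv_nth)
  have "tree_decomposition G T (\<lambda>t. Xs ! t)"
    unfolding tree_decomposition_def
  proof (intro conjI ballI)
    show "undirected_tree T" using T(2-4) by (rule undirected_treeI)
    show "Xs ! t \<subseteq> pverts G" if "t \<in> pverts T" for t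
      using that assms(2) T(1) nth_mem by blast
    show "\<exists>t\<in>pverts T. u \<in> Xs ! t" if "u \<in> pverts G" for u
      using that assms(2) nth[of "\<lambda>X. u \<in> X"] by auto
    show "case e of (u, v) \<Rightarrow> \<exists>t\<in>pverts T. u \<in> Xs ! t \<and> v \<in> Xs ! t" if "e \<in> parcs G" for e
      using that assms(3) nth by (cases e) auto
    show "connected (with_proj T \<restriction> {t \<in> pverts T. u \<in> Xs ! t})" if "u \<in> pverts G" for u
      using connected_induced_if_conn_set[OF T(5)] that assms(2) by simp
  qed
  then show thesis using that T(1) by blast
qed

section \<open>From models to induced minors\<close>

text \<open>The branch sets are mapped by the contraction map \<open>f\<close>. As both ends of the
  contracted edge lie in one branch set, no two branch sets are merged and no adjacency between them
  changes.\<close>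

lemma minor_model_contract:
  assumes G: "pair_graph G" and H: "minor_model H (pverts G) (parcs G) M"
    and uv: "(u, v) \<in> parcs G" "i \<in> pverts H" "u \<in> M i" "v \<in> M i"
  shows "\<exists>M'. minor_model H (pverts (contract_edge G u v)) (parcs (contract_edge G u v)) M'"
proof
  define f where "f = (\<lambda>x. if x = v then u else x)"
  let ?E = "parcs G" and ?G' = "contract_edge G u v"
  have V': "pverts ?G' = f ` pverts G"
    and E': "parcs ?G' = {(f x, f y) | x y. (x, y) \<in> ?E \<and> f x \<noteq> f y}"
    by (simp_all add: contract_edge_def f_def Let_def)
  have M: "\<And>j. j \<in> pverts H \<Longrightarrow> M j \<subseteq> pverts G \<and> conn_set ?E (M j)"
    "\<And>j k. j \<in> pverts H \<Longrightarrow> k \<in> pverts H \<Longrightarrow> j \<noteq> k \<Longrightarrow> M j \<inter> M k = {}"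
    "\<And>j k. j \<in> pverts H \<Longrightarrow> k \<in> pverts H \<Longrightarrow> j \<noteq> k \<Longrightarrow> touching ?E (M j) (M k) \<longleftrightarrow> (j, k) \<in> parcs H"
    using H unfolding minor_model_def by blast+
  \<comment> \<open>Every branch set is a union of fibres of \<open>f\<close>, since the only fibre
    with two elements, that of \<open>u\<close> and \<open>v\<close>, lies in
    \<open>M i\<close>.\<close>
  have sat: "x \<in> M j" if "f x \<in> f ` M j" "j \<in> pverts H" for x j
  proof -
    obtain y where y: "y \<in> M j" "f x = f y" using \<open>f x \<in> f ` M j\<close> by auto
    show ?thesis
    proof (cases "j = i")
      case True
      then show ?thesis using y uv(3,4) by (auto simp: f_def split: if_splits)
    next
      case False
      then have "y \<noteq> u" "y \<noteq> v" using M(2)[OF uv(2) that(2)] uv(3,4) y(1) by auto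
      then show ?thesis using y by (auto simp: f_def split: if_splits)
    qed
  qed
  have disj: "f ` M j \<inter> f ` M k = {}" if "j \<in> pverts H" "k \<in> pverts H" "j \<noteq> k" for j k
    using sat that M(2)[OF that] by blast
  show "minor_model H (pverts ?G') (parcs ?G') (\<lambda>j. f ` M j)"
    unfolding minor_model_def
  proof (intro conjI ballI impI)
    fix j assume j: "j \<in> pverts H"
    show "f ` M j \<subseteq> pverts ?G'" unfolding V' using M(1)[OF j] by blast
    have "(f x, f y) \<in> (Restr (parcs ?G') (f ` M j))\<^sup>*" if "(x, y) \<in> (Restr ?E (M j))\<^sup>*" for x y
      using that
    proof induction
      case (step y z)
      show ?case
      proof (cases "f y = f z")
        case False
        then have "(f y, f z) \<in> Restr (parcs ?G') (f ` M j)" using step(2) by (auto simp: E')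
        then show ?thesis using step.IH by (rule rtrancl_into_rtrancl[rotated])
      qed (use step.IH in simp)
    qed simp
    then show "conn_set (parcs ?G') (f ` M j)" using M(1)[OF j] by (auto simp: conn_set_def)
  next
    fix j k assume jk: "j \<in> pverts H" "k \<in> pverts H" "j \<noteq> k"
    show "f ` M j \<inter> f ` M k = {}" using disj[OF jk] .
    have "touching (parcs ?G') (f ` M j) (f ` M k) \<longleftrightarrow> touching ?E (M j) (M k)"
    proof
      assume "touching (parcs ?G') (f ` M j) (f ` M k)"
      then obtain a b where "a \<in> f ` M j" "b \<in> f ` M k" "(a, b) \<in> parcs ?G'"
        unfolding touching_def by blast
      moreover from this(3) obtain x y where xy: "a = f x" "b = f y" "(x, y) \<in> ?E"
        unfolding E' by blast
      ultimately have "x \<in> M j" "y \<in> M k"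
        using sat[of x j] sat[of y k] jk(1,2) by simp_all
      then show "touching ?E (M j) (M k)" using xy(3) unfolding touching_def by blast
    next
      assume "touching ?E (M j) (M k)"
      then obtain x y where xy: "x \<in> M j" "y \<in> M k" "(x, y) \<in> ?E" by (auto simp: touching_def)
      then have "f x \<noteq> f y" using disj[OF jk] by (metis disjoint_iff imageI)
      then have "(f x, f y) \<in> parcs ?G'" using xy(3) by (auto simp: E')
      then show "touching (parcs ?G') (f ` M j) (f ` M k)" using xy by (auto simp: touching_def)
    qed
    then show "touching (parcs ?G') (f ` M j) (f ` M k) \<longleftrightarrow> (j, k) \<in> parcs H" using M(3)[OF jk] by simp
  qed
qed

lemma conn_set_edge:
  assumes "conn_set E A" "x \<in> A" "y \<in> A" "x \<noteq> y"
  obtains z where "z \<in> A" "(x, z) \<in> E"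
proof -
  have "(x, y) \<in> (Restr E A)\<^sup>*" using conn_setD[OF assms(1-3)] by simp
  then show thesis using that assms(4) by (cases rule: converse_rtranclE) auto
qed

lemma digraph_iso_of_spanning_singletons:
  assumes G: "pair_graph G" and "pair_graph H"
    and "minor_model H (pverts G) (parcs G) (\<lambda>i. {m i})" "pverts G = m ` pverts H"
  shows "digraph_iso (with_proj G) (with_proj H)"
proof -
  have inj: "inj_on m (pverts H)"
    and adj: "\<And>i j. i \<in> pverts H \<Longrightarrow> j \<in> pverts H \<Longrightarrow> i \<noteq> j \<Longrightarrow>
      (m i, m j) \<in> parcs G \<longleftrightarrow> (i, j) \<in> parcs H"
    using assms(3) by (auto simp: minor_model_def inj_on_def touching_def)
  define g where "g = the_inv_into (pverts H) m"
  have gm: "g (m i) = i" if "i \<in> pverts H" for i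
    using the_inv_into_f_f[OF inj that] by (simp add: g_def)
  have GE: "parcs G \<subseteq> pverts G \<times> pverts G" "irrefl (parcs G)"
    and HE: "parcs H \<subseteq> pverts H \<times> pverts H" "irrefl (parcs H)"
    using assms(1,2) by (auto simp: pair_graph_iff)
  have injg: "inj_on g (pverts G)" using gm assms(4) by (auto simp: inj_on_def)
  \<comment> \<open>Arcs are pairs, so the arc map is induced by the vertex map \<open>g\<close>,
    the inverse of \<open>m\<close>.\<close>
  define hom where "hom = \<lparr>iso_verts = g, iso_arcs = map_prod g g, iso_head = snd, iso_tail = fst\<rparr>"
  interpret pair_graph G by (rule G)
  have arcs: "map_prod g g ` parcs G = parcs H"
  proof (intro equalityI subsetI)
    fix e assume "e \<in> map_prod g g ` parcs G"
    then obtain x y where xy: "(x, y) \<in> parcs G" "e = (g x, g y)" by auto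
    then obtain i j where ij: "x = m i" "y = m j" "i \<in> pverts H" "j \<in> pverts H"
      using GE(1) assms(4) by blast
    then have "i \<noteq> j" using xy GE(2) by (auto simp: irrefl_def)
    then show "e \<in> parcs H" using adj ij xy gm by simp
  next
    fix e assume e: "e \<in> parcs H"
    then obtain i j where ij: "e = (i, j)" "i \<in> pverts H" "j \<in> pverts H" using HE(1) by auto
    then have "i \<noteq> j" using e HE(2) by (auto simp: irrefl_def)
    then have "(m i, m j) \<in> parcs G" using adj ij e by simp
    then show "e \<in> map_prod g g ` parcs G" using ij gm[of i] gm[of j]
      by (intro image_eqI[of _ _ "(m i, m j)"]) auto
  qed
  have "inj_on (map_prod g g) (parcs G)"
    using map_prod_inj_on[OF injg injg] GE(1) by (rule inj_on_subset)
  then have "digraph_isomorphism hom"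
    unfolding digraph_isomorphism_def using injg wf_digraph_axioms by (simp add: hom_def)
  moreover have "with_proj H = app_iso hom (with_proj G)"
    using arcs assms(4) gm by (auto simp: app_iso_def hom_def with_proj_def image_image)
  ultimately show ?thesis unfolding digraph_iso_def by blast
qed

text \<open>Induction on the number of vertices: an edge inside a branch set with two vertices is
  contracted, and once all branch sets are singletons an uncovered vertex is deleted. A model by
  singletons covering everything is an isomorphism.\<close>

lemma not_induced_minor_free_if_minor_model:
  assumes "pair_graph G" "pair_graph H" "minor_model H (pverts G) (parcs G) M"
  shows "\<not> induced_minor_free H G"
proof -
  have "\<exists>G'. reduces_to G G' \<and> digraph_iso (with_proj G') (with_proj H)"
    if "reduces_to G K" "minor_model H (pverts K) (parcs K) M" for K M
    using that
  proof (induction "card (pverts K)" arbitrary: K M rule: less_induct)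
    case less
    have K: "pair_graph K" using reduces_to_pair_graph[OF less.prems(1) assms(1)] .
    then have fin: "finite (pverts K)" by (simp add: pair_graph_iff)
    have M: "\<And>i. i \<in> pverts H \<Longrightarrow> M i \<subseteq> pverts K \<and> conn_set (parcs K) (M i)"
      using less.prems(2) unfolding minor_model_def by blast
    show ?case
    proof (cases "\<exists>i\<in>pverts H. \<exists>x\<in>M i. \<exists>y\<in>M i. x \<noteq> y")
      case True
      then obtain i x y where i: "i \<in> pverts H" "x \<in> M i" "y \<in> M i" "x \<noteq> y" by blast
      obtain z where z: "z \<in> M i" "(x, z) \<in> parcs K"
        using conn_set_edge[of "parcs K" "M i" x y] M[OF i(1)] i(2-4) by blast
      then have xz: "x \<noteq> z" "x \<in> pverts K" "z \<in> pverts K"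
        using K by (auto simp: pair_graph_iff irrefl_def)
      have "pverts (contract_edge K x z) = pverts K - {z}"
        using xz by (auto simp: contract_edge_def Let_def)
      then have "card (pverts (contract_edge K x z)) < card (pverts K)"
        using card_Diff1_less[OF fin xz(3)] by simp
      then show ?thesis
        using less.hyps reduces_to.contract[OF less.prems(1) z(2)]
          minor_model_contract[OF K less.prems(2) z(2) i(1,2) z(1)] by blast
    next
      case single: False
      show ?thesis
      proof (cases "pverts K \<subseteq> \<Union>(M ` pverts H)")
        case False
        then obtain v where v: "v \<in> pverts K" "\<And>i. i \<in> pverts H \<Longrightarrow> v \<notin> M i" by blast
        have "minor_model H (pverts K - {v}) (parcs K) M"
          using less.prems(2) v(2) unfolding minor_model_def by blast
        then have "minor_model H (pverts K - {v}) (parcs (delete_vertex K v)) M"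
          by (rule minor_model_cong[THEN iffD1, rotated]) (auto simp: delete_vertex_def)
        moreover have "pverts (delete_vertex K v) = pverts K - {v}" by (simp add: delete_vertex_def)
        moreover have "card (pverts K - {v}) < card (pverts K)"
          using fin v(1) by (rule card_Diff1_less)
        ultimately show ?thesis
          using less.hyps[of "delete_vertex K v" M] reduces_to.delete[OF less.prems(1) v(1)] by simp
      next
        case True
        define m where "m = (\<lambda>i. SOME x. x \<in> M i)"
        have Mm: "M i = {m i}" if "i \<in> pverts H" for i
        proof -
          have "m i \<in> M i" unfolding m_def
            using M[OF that] conn_set_nonempty some_in_eq by metis
          then show ?thesis using single that by blast
        qed
        have "minor_model H (pverts K) (parcs K) (\<lambda>i. {m i})"
          using less.prems(2) Mm unfolding minor_model_def by simp
        moreover have "pverts K = m ` pverts H" using True M Mm by auto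
        ultimately have "digraph_iso (with_proj K) (with_proj H)"
          using digraph_iso_of_spanning_singletons[OF K assms(2)] by blast
        then show ?thesis using less.prems(1) by blast
      qed
    qed
  qed
  from this[OF reduces_to.refl assms(3)] show ?thesis by (simp add: induced_minor_free_def)
qed

section \<open>Independence numbers of bags and the final bound\<close>

lemma independence_number_le:
  assumes "finite X" "\<And>I. I \<subseteq> X \<Longrightarrow> \<forall>x\<in>I. \<forall>y\<in>I. (x, y) \<notin> parcs G \<Longrightarrow> card I \<le> k"
  shows "independence_number (with_proj G \<restriction> X) \<le> k"
proof -
  have ind: "independent_set (with_proj G \<restriction> X) S \<longleftrightarrow> S \<subseteq> X \<and> (\<forall>x\<in>S. \<forall>y\<in>S. (x, y) \<notin> parcs G)" for S
    by (auto simp: independent_set_def arcs_ends_conv induce_subgraph_def image_iff)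
  let ?I = "{S. independent_set (with_proj G \<restriction> X) S}"
  have "?I \<subseteq> Pow X" by (auto simp: ind)
  then have "finite ?I" using assms(1) by (simp add: finite_subset)
  moreover have "{} \<in> ?I" by (simp add: ind)
  moreover have "card S \<le> k" if "S \<in> ?I" for S using that assms(2) by (simp add: ind)
  ultimately show ?thesis
    unfolding independence_number_def by (intro Max.boundedI) blast+
qed

theorem corollary5p7:
  fixes G :: "'a pair_pre_digraph"
  assumes "pair_graph G"
    and "induced_minor_free W4 G"
  shows "tree_independence_number G \<le> 4"
proof -
  have G: "finite (pverts G)" "parcs G \<subseteq> pverts G \<times> pverts G" "sym (parcs G)"
    using assms(1) by (auto simp: pair_graph_iff)
  \<comment> \<open>The recursion starts without virtual edges, where this is implied by
    induced-minor-freeness, and with the empty clique as root.\<close>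
  have "W4_free_with (pverts G) (parcs G) {}"
    using not_induced_minor_free_if_minor_model[OF assms(1) pair_graph_W4] assms(2)
    by (auto simp: W4_free_with_def)
  then obtain Xs where Xs: "rooted_decomposition (parcs G) {} (pverts G) {} Xs"
    using rooted_decomposition_exists[OF G(1,3), of "{}" "{}"] by (auto simp: clique_in_def sym_def)
  then have bags: "bag_tree Xs" "\<Union>(set Xs) = pverts G"
    and cover: "\<And>x y. x \<in> pverts G \<Longrightarrow> y \<in> pverts G \<Longrightarrow> (x, y) \<in> parcs G \<union> {} \<Longrightarrow>
      \<exists>X\<in>set Xs. x \<in> X \<and> y \<in> X"
    and small: "\<And>X I. X \<in> set Xs \<Longrightarrow> I \<subseteq> X \<Longrightarrow> \<forall>x\<in>I. \<forall>y\<in>I. (x, y) \<notin> parcs G \<Longrightarrow> card I \<le> 4"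
    unfolding rooted_decomposition_def by blast+
  obtain T :: "nat pair_pre_digraph" where T: "pverts T = {..<length Xs}"
    "tree_decomposition G T (\<lambda>t. Xs ! t)"
    using tree_decomposition_of_bag_tree[OF bags] cover G(2) by (metis Un_empty_right mem_Sigma_iff subsetD)
  have "independence_number (with_proj G \<restriction> Xs ! t) \<le> 4" if "t \<in> pverts T" for t
  proof (rule independence_number_le)
    have t: "Xs ! t \<in> set Xs" using that T(1) by simp
    then have "Xs ! t \<subseteq> pverts G" using bags(2) Union_upper by metis
    then show "finite (Xs ! t)" using G(1) by (rule finite_subset)
    show "card I \<le> 4" if "I \<subseteq> Xs ! t" "\<forall>x\<in>I. \<forall>y\<in>I. (x, y) \<notin> parcs G" for I
      using small[OF t that] .
  qed
  then have "decomposition_independence_number G T (\<lambda>t. Xs ! t) \<le> 4"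
    unfolding decomposition_independence_number_def
    using T(1) bag_tree_nonempty[OF bags(1)] by (subst Max_le_iff) auto
  moreover have "tree_independence_number G \<le> decomposition_independence_number G T (\<lambda>t. Xs ! t)"
    unfolding tree_independence_number_def using T(2) by (intro Least_le) blast
  ultimately show ?thesis by simp
qed

end
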